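(* Let $(m_n)_{n\ge1}$ be a sequence of positive integers with $\lim_{n\to\infty}\frac{m_n}{n}=\infty$. For each $n$, let $A=A(n)$ be an $m_n\times n$ random matrix whose entries are mutually independent standard Gaussian variables. Then the spherical mean width $\mathcal{W}(P)$ of the polyhedron $P=P(n)=\{x\in\mathbb{R}^n:\ Ax\le\mathbf{1}\}$ satisfies $$\lim_{n\to\infty}\sqrt{2\log(m_n/n)}\,\mathcal{W}(P)=2\quad\text{almost surely.}$$
   Context: $\mathbf{1}$ is the vector of all ones and inequalities between vectors are coordinate-wise. The spherical mean width is $\mathcal{W}(P)=2\,\mathbb{E}_c\max\{\langle c,x\rangle:\ x\in P\}$ (with supremum in place of maximum if needed, values in $[0,+\infty]$), where $c$ is uniformly distributed on the unit Euclidean sphere of $\mathbb{R}^n$, independent of $A$, and $\mathbb{E}_c$ is the expectation with respect to the randomness of $c$ only; thus $\mathcal{W}(P)$ is a random variable depending on $A$. The matrices $A(n)$, $n\ge1$, are defined on a common probability space. *)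

theory Defs
  imports "HOL-Probability.Probability"
begin

text \<open>
  The dimension \<open>n\<close> varies, so n-dimensional space is represented by the extensional functions
  in \<open>{..<n} \<rightarrow>\<^sub>E UNIV\<close>, which is the space of the product measure on the index set \<open>{..<n}\<close>.
\<close>

definition inner_prod :: "nat \<Rightarrow> (nat \<Rightarrow> real) \<Rightarrow> (nat \<Rightarrow> real) \<Rightarrow> real" where
  "inner_prod n x y = (\<Sum>i<n. x i * y i)"

definition unit_ball :: "nat \<Rightarrow> (nat \<Rightarrow> real) set" where
  "unit_ball n = {x \<in> {..<n} \<rightarrow>\<^sub>E UNIV. L2_set x {..<n} \<le> 1}"

definition unit_sphere :: "nat \<Rightarrow> (nat \<Rightarrow> real) set" where
  "unit_sphere n = {x \<in> {..<n} \<rightarrow>\<^sub>E UNIV. L2_set x {..<n} = 1}"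

text \<open>
  The uniform distribution on the unit sphere, as the normalised cone measure: the mass of a
  set \<open>S\<close> of directions is the Lebesgue measure of the cone \<open>{t * s | s \<in> S, 0 < t \<le> 1}\<close> divided by
  that of the unit ball. It is the law of \<open>x / |x|\<close> for \<open>x\<close> uniform in the unit ball; the value
  of this map at the origin is irrelevant for \<open>n \<ge> 1\<close>.
\<close>

definition normalize_vec :: "nat \<Rightarrow> (nat \<Rightarrow> real) \<Rightarrow> (nat \<Rightarrow> real)" where
  "normalize_vec n x = (\<lambda>i\<in>{..<n}. x i / L2_set x {..<n})"

definition uniform_sphere :: "nat \<Rightarrow> (nat \<Rightarrow> real) measure" where
  "uniform_sphere n =
     distr (uniform_measure (\<Pi>\<^sub>M i\<in>{..<n}. lborel) (unit_ball n))
           (\<Pi>\<^sub>M i\<in>{..<n}. borel) (normalize_vec n)"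

definition support_function :: "nat \<Rightarrow> (nat \<Rightarrow> real) set \<Rightarrow> (nat \<Rightarrow> real) \<Rightarrow> ereal" where
  "support_function n P c = (SUP x\<in>P. ereal (inner_prod n c x))"

text \<open>
  Conversion to \<open>ennreal\<close> truncates negative values at 0. The definition is meant for sets \<open>P\<close>
  containing the origin, whose support function is nonnegative.
\<close>

definition mean_width :: "nat \<Rightarrow> (nat \<Rightarrow> real) set \<Rightarrow> ennreal" where
  "mean_width n P = 2 * (\<integral>\<^sup>+ c. e2ennreal (support_function n P c) \<partial>uniform_sphere n)"

definition polyhedron_of :: "nat \<Rightarrow> nat \<Rightarrow> (nat \<Rightarrow> nat \<Rightarrow> real) \<Rightarrow> (nat \<Rightarrow> real) set" where
  "polyhedron_of k n B = {x \<in> {..<n} \<rightarrow>\<^sub>E UNIV. \<forall>i<k. (\<Sum>j<n. B i j * x j) \<le> 1}"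

lemma support_function_polyhedron_nonneg: "0 \<le> support_function n (polyhedron_of k n B) c"
proof -
  have "(\<lambda>i\<in>{..<n}. 0) \<in> polyhedron_of k n B"
    by (auto simp: polyhedron_of_def)
  then have "ereal (inner_prod n c (\<lambda>i\<in>{..<n}. 0)) \<le> support_function n (polyhedron_of k n B) c"
    unfolding support_function_def by (rule SUP_upper)
  then show ?thesis
    by (simp add: inner_prod_def zero_ereal_def)
qed

lemma sets_unit_ball [measurable]: "unit_ball n \<in> sets (\<Pi>\<^sub>M i\<in>{..<n}. lborel)"
proof -
  have "unit_ball n =
      {x \<in> space (\<Pi>\<^sub>M i\<in>{..<n}. lborel). sqrt (\<Sum>i<n. (x i)\<^sup>2) \<le> 1}"
    by (auto simp: unit_ball_def space_PiM L2_set_def)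
  also have "\<dots> \<in> sets (\<Pi>\<^sub>M i\<in>{..<n}. lborel)"
    by measurable
  finally show ?thesis .
qed

lemma emeasure_unit_ball:
  "emeasure (\<Pi>\<^sub>M i\<in>{..<n}. lborel) (unit_ball n) = ennreal (unit_ball_vol (real n))"
  if "n \<ge> 1"
proof -
  have "unit_ball n = {x. sqrt (\<Sum>i<n. (x i)\<^sup>2) \<le> 1} \<inter> space (\<Pi>\<^sub>M i\<in>{..<n}. lborel)"
    by (auto simp: unit_ball_def space_PiM L2_set_def)
  then show ?thesis
    using emeasure_cball_aux[of "{..<n}" 1] that by auto
qed

lemma measurable_normalize_vec [measurable]:
  "normalize_vec n \<in> measurable (\<Pi>\<^sub>M i\<in>{..<n}. lborel) (\<Pi>\<^sub>M i\<in>{..<n}. borel)"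
  unfolding normalize_vec_def L2_set_def by measurable

lemma prob_space_uniform_sphere: "prob_space (uniform_sphere n)" if "n \<ge> 1"
proof -
  have "prob_space (uniform_measure (\<Pi>\<^sub>M i\<in>{..<n}. lborel) (unit_ball n))"
    using unit_ball_vol_pos[of "real n"]
    by (intro prob_space_uniform_measure) (simp_all add: emeasure_unit_ball[OF that] del: unit_ball_vol_pos)
  then show ?thesis
    unfolding uniform_sphere_def by (rule prob_space.prob_space_distr) simp
qed

lemma normalize_vec_in_unit_sphere:
  assumes "L2_set x {..<n} \<noteq> 0"
  shows "normalize_vec n x \<in> unit_sphere n"
proof -
  let ?r = "L2_set x {..<n}"
  have "L2_set (normalize_vec n x) {..<n} = L2_set (\<lambda>i. (1 / ?r) * x i) {..<n}"
    by (rule L2_set_cong) (auto simp: normalize_vec_def)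
  also have "\<dots> = (1 / ?r) * ?r"
    by (rule L2_set_right_distrib[symmetric]) (simp add: L2_set_nonneg)
  finally show ?thesis
    using assms by (auto simp: unit_sphere_def normalize_vec_def)
qed

lemma AE_uniform_sphere: "AE c in uniform_sphere n. c \<in> unit_sphere n" if "n \<ge> 1"
proof -
  let ?L = "\<Pi>\<^sub>M i\<in>{..<n}. lborel :: real measure"
  interpret product_sigma_finite "\<lambda>_ :: nat. lborel :: real measure" ..
  have "emeasure ?L ({..<n} \<rightarrow>\<^sub>E {0}) = (\<Prod>i<n. emeasure lborel {0 :: real})"
    by (rule emeasure_PiM) auto
  also have "\<dots> = 0"
    using that by (auto simp: power_0_left)
  finally have "({..<n} \<rightarrow>\<^sub>E {0}) \<in> null_sets ?L"
    by (rule null_setsI) (rule sets_PiM_I_finite, auto)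
  then have "AE x in ?L. x \<notin> {..<n} \<rightarrow>\<^sub>E {0}"
    by (rule AE_not_in)
  then have *: "AE x in ?L. normalize_vec n x \<in> unit_sphere n"
  proof (rule AE_mp, intro AE_I2 impI)
    fix x assume "x \<in> space ?L" and x: "x \<notin> {..<n} \<rightarrow>\<^sub>E {0}"
    then have "\<exists>i<n. x i \<noteq> 0"
      unfolding space_PiM PiE_iff by blast
    then have "L2_set x {..<n} \<noteq> 0"
      by (auto simp: L2_set_eq_0_iff)
    then show "normalize_vec n x \<in> unit_sphere n"
      by (rule normalize_vec_in_unit_sphere)
  qed
  have meas: "{x \<in> space (\<Pi>\<^sub>M i\<in>{..<n}. borel). x \<in> unit_sphere n} \<in> sets (\<Pi>\<^sub>M i\<in>{..<n}. borel)"
  proof -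
    have "{x \<in> space (\<Pi>\<^sub>M i\<in>{..<n}. borel). x \<in> unit_sphere n} =
        {x \<in> space (\<Pi>\<^sub>M i\<in>{..<n}. borel). sqrt (\<Sum>i<n. (x i)\<^sup>2) = (1 :: real)}"
      by (auto simp: unit_sphere_def space_PiM L2_set_def)
    also have "\<dots> \<in> sets (\<Pi>\<^sub>M i\<in>{..<n}. borel)"
      by measurable
    finally show ?thesis .
  qed
  have "AE x in uniform_measure ?L (unit_ball n). normalize_vec n x \<in> unit_sphere n"
    using * by (intro AE_uniform_measureI) auto
  then show ?thesis
    unfolding uniform_sphere_def by (subst AE_distr_iff[OF _ meas]) auto
qed

end

theory Submission
  imports Defs "HOL-Real_Asymp.Real_Asymp"
begin

text \<open>
  Write \<open>a\<^sub>i\<close> for the rows of \<open>A\<close>, \<open>L = ln (m / n)\<close> and \<open>s = sqrt (2 L)\<close>.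

  Upper bound. For unit vectors \<open>x\<close> and \<open>v\<close> of a fine net and \<open>t\<close> slightly below \<open>s\<close>, far more
  than \<open>n\<close> rows satisfy \<open>\<langle>a\<^sub>i, x\<rangle> \<ge> t\<close>, and their sum is controlled in the direction \<open>v\<close>, with a
  failure probability that survives a union bound over the net. Hence every unit vector \<open>u\<close> has
  \<open>\<langle>a\<^sub>i, u\<rangle> \<ge> (1 - \<epsilon>) s\<close> for some \<open>i\<close>, that is, \<open>P\<close> lies in a ball of radius about \<open>1 / s\<close>.

  Lower bound. By duality, the support function of \<open>P\<close> at a unit vector \<open>c\<close> is at least \<open>1 / \<mu>\<close> unless
  \<open>\<mu> c\<close> is a subconvex combination \<open>\<Sum>\<^sub>i y\<^sub>i a\<^sub>i\<close>. Pairing with \<open>c\<close> gives \<open>\<mu> \<le> \<tau> + |y| N\<close>, where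
  \<open>N\<^sup>2 = \<Sum>\<^sub>i (\<langle>a\<^sub>i, c\<rangle> - \<tau>)\<^sub>+\<^sup>2\<close> is much smaller than \<open>n\<close> when \<open>\<tau> = (1 + \<epsilon>) s\<close>. On the other hand,
  approximating \<open>y\<close> by an average of about \<open>n / (4 L)\<close> coordinate vectors, for which \<open>A\<^sup>T\<close> is bounded
  below on all such averages at once, yields \<open>sqrt n |y| \<le> C (|A\<^sup>T y| + s) = C (\<mu> + s)\<close>. Together,
  \<open>\<mu> \<le> (1 + 2 \<epsilon>) s\<close>. The bound on \<open>N\<close> holds for each fixed \<open>c\<close> with exponentially small failure
  probability, so by Fubini it holds for most directions \<open>c\<close> with high probability in \<open>A\<close>.
\<close>

section \<open>Deterministic estimates\<close>

lemma L2_set_power2: "(L2_set f I)\<^sup>2 = (\<Sum>i\<in>I. (f i)\<^sup>2)"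
  by (simp add: L2_set_def sum_nonneg)

lemma L2_set_uminus: "L2_set (\<lambda>i. - f i) I = L2_set f I"
  by (simp add: L2_set_def)

lemma L2_set_scale: "L2_set (\<lambda>i. r * f i) I = \<bar>r\<bar> * L2_set f I"
  by (simp add: L2_set_def power_mult_distrib real_sqrt_mult flip: sum_distrib_left)

lemma L2_set_normalize:
  assumes "L2_set f I \<noteq> 0"
  shows "L2_set (\<lambda>i. f i / L2_set f I) I = 1"
  using assms L2_set_scale[of "1 / L2_set f I" f I] by simp

lemma L2_set_triangle_diff: "L2_set f I \<le> L2_set g I + L2_set (\<lambda>i. f i - g i) I"
  using L2_set_triangle_ineq[of g "\<lambda>i. f i - g i" I] by simp

lemma L2_set_diff_commute: "L2_set (\<lambda>i. f i - g i) I = L2_set (\<lambda>i. g i - f i) I"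
  by (simp add: L2_set_def power2_commute)

lemma sum_mult_le_L2_set: "(\<Sum>i\<in>I. f i * g i) \<le> L2_set f I * L2_set g I"
proof -
  have "(\<Sum>i\<in>I. f i * g i) \<le> (\<Sum>i\<in>I. \<bar>f i\<bar> * \<bar>g i\<bar>)"
    by (intro sum_mono) (simp flip: abs_mult)
  then show ?thesis
    using L2_set_mult_ineq[of f g I] by linarith
qed

lemma sum_mult_ge_L2_set: "- (L2_set f I * L2_set g I) \<le> (\<Sum>i\<in>I. f i * g i)"
  using sum_mult_le_L2_set[of "\<lambda>i. - f i" g I] by (simp add: L2_set_uminus sum_negf)

text \<open>The product weight, summed over all functions, factorises into a power of the
  one-coordinate sum, and every element of \<open>S\<close> contributes at least
  \<open>\<theta>\<close>. Used to count lattice points and compositions.\<close>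

lemma card_le_of_weight:
  fixes w :: "'b \<Rightarrow> real"
  assumes "finite I" "finite J" "S \<subseteq> I \<rightarrow>\<^sub>E J" "\<And>j. j \<in> J \<Longrightarrow> 0 \<le> w j"
    and "\<And>z. z \<in> S \<Longrightarrow> \<theta> \<le> (\<Prod>i\<in>I. w (z i))"
  shows "real (card S) * \<theta> \<le> (\<Sum>j\<in>J. w j) ^ card I"
proof -
  have fin: "finite (I \<rightarrow>\<^sub>E J)"
    using assms by (intro finite_PiE) auto
  have "real (card S) * \<theta> = (\<Sum>z\<in>S. \<theta>)"
    by simp
  also have "\<dots> \<le> (\<Sum>z\<in>S. \<Prod>i\<in>I. w (z i))"
    by (intro sum_mono assms)
  also have "\<dots> \<le> (\<Sum>z\<in>I \<rightarrow>\<^sub>E J. \<Prod>i\<in>I. w (z i))"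
    using assms fin by (intro sum_mono2) (auto intro!: prod_nonneg)
  also have "\<dots> = (\<Prod>i\<in>I. \<Sum>j\<in>J. w j)"
    using assms by (subst prod_sum_PiE) auto
  finally show ?thesis
    by simp
qed

text \<open>The one-coordinate weight sum for the lattice count: a truncated two-sided geometric
  series whose full total is 3.\<close>

lemma sum_half_power_abs_le: "(\<Sum>j\<in>{- int N..int N}. (1/2::real) ^ nat \<bar>j\<bar>) \<le> 3"
proof -
  have pos: "(\<Sum>j\<in>{1..int N}. (1/2::real) ^ nat \<bar>j\<bar>) \<le> 1"
  proof -
    have "(\<Sum>j\<in>{1..int N}. (1/2::real) ^ nat \<bar>j\<bar>) = (\<Sum>j\<in>{1..N}. (1/2::real) ^ j)"
      by (intro sum.reindex_bij_witness[of _ int nat]) auto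
    also have "\<dots> = 1 - (1/2)^N"
      by (induction N) (auto simp: field_simps)
    finally show ?thesis by simp
  qed
  have neg: "(\<Sum>j\<in>{- int N..-1}. (1/2::real) ^ nat \<bar>j\<bar>) = (\<Sum>j\<in>{1..int N}. (1/2::real) ^ nat \<bar>j\<bar>)"
    by (intro sum.reindex_bij_witness[of _ uminus uminus]) auto
  have "{- int N..int N} = {- int N..-1} \<union> {0} \<union> {1..int N}"
    by auto
  then have "(\<Sum>j\<in>{- int N..int N}. (1/2::real) ^ nat \<bar>j\<bar>) =
      (\<Sum>j\<in>{- int N..-1} \<union> {0} \<union> {1..int N}. (1/2::real) ^ nat \<bar>j\<bar>)"
    by simp
  also have "\<dots> = (\<Sum>j\<in>{- int N..-1}. (1/2::real) ^ nat \<bar>j\<bar>) + 1 + (\<Sum>j\<in>{1..int N}. (1/2::real) ^ nat \<bar>j\<bar>)"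
    by (subst sum.union_disjoint, auto)+
  finally show ?thesis
    using pos neg by simp
qed

text \<open>The net consists of the normalised points of a cubic lattice of mesh of order \<open>\<epsilon> / \<surd>n\<close>.\<close>

lemma sphere_net:
  fixes \<epsilon> :: real
  assumes \<epsilon>: "0 < \<epsilon>" "\<epsilon> \<le> 1"
  obtains K :: real where "K \<ge> 1" "\<And>n. n \<ge> 1 \<Longrightarrow>
      \<exists>T. finite T \<and> real (card T) \<le> K ^ n \<and> (\<forall>x\<in>T. L2_set x {..<n} = 1) \<and>
        (\<forall>u. L2_set u {..<n} = 1 \<longrightarrow> (\<exists>x\<in>T. L2_set (\<lambda>i. u i - x i) {..<n} \<le> \<epsilon>))"
proof
  \<comment> \<open>Half of \<open>\<epsilon>\<close> pays for rounding to the lattice, the other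
    half for normalising the rounded point.\<close>
  define \<delta> where "\<delta> = \<epsilon> / 2"
  have \<delta>: "0 < \<delta>" "\<delta> \<le> 1/2"
    using \<epsilon> by (auto simp: \<delta>_def)
  \<comment> \<open>\<open>B\<close> will bound the mean of \<open>\<bar>z i\<bar>\<close> over the
    coordinates: \<open>\<bar>z i\<bar>\<close> is at most \<open>(1 + (z i)\<^sup>2) / 2\<close>,
    and the squares sum to at most \<open>real n * (4 / \<delta>\<^sup>2)\<close>.\<close>
  define B :: real where "B = (1 + 4 / \<delta>\<^sup>2) / 2"
  have "B \<ge> 0" using \<delta> by (simp add: B_def)
  \<comment> \<open>Per coordinate, 3 is the weight sum and \<open>2 powr B\<close> compensates the
    minimal weight of a lattice point in \<open>G\<close>.\<close>
  define K :: real where "K = 3 * 2 powr B"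
  show "K \<ge> 1"
    using \<open>B \<ge> 0\<close> ge_one_powr_ge_zero[of 2 B] by (simp add: K_def)
  fix n :: nat
  assume n: "n \<ge> 1"
  define r where "r = \<delta> / sqrt (real n)"
  have r: "r > 0" "r\<^sup>2 * real n = \<delta>\<^sup>2"
    using n \<delta> by (auto simp: r_def power_divide)
  define N :: nat where "N = nat \<lceil>real n * B\<rceil>"
  define G where "G = {z \<in> {..<n} \<rightarrow>\<^sub>E {- int N..int N}. real (\<Sum>i<n. nat \<bar>z i\<bar>) \<le> real n * B}"
  have "real (card G) * (1/2) powr (real n * B) \<le> (\<Sum>j\<in>{- int N..int N}. (1/2::real) ^ nat \<bar>j\<bar>) ^ card {..<n}"
  proof (rule card_le_of_weight)
    fix z assume "z \<in> G"
    have "(\<Prod>i<n. (1/2::real) ^ nat \<bar>z i\<bar>) = (1/2) ^ (\<Sum>i<n. nat \<bar>z i\<bar>)"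
      by (simp add: power_sum)
    also have "\<dots> = (1/2) powr real (\<Sum>i<n. nat \<bar>z i\<bar>)"
      by (rule powr_realpow[symmetric]) simp
    also have "\<dots> \<ge> (1/2) powr (real n * B)"
      using \<open>z \<in> G\<close> by (intro powr_mono') (auto simp: G_def)
    finally show "(1/2) powr (real n * B) \<le> (\<Prod>i<n. (1/2::real) ^ nat \<bar>z i\<bar>)" .
  qed (auto simp: G_def)
  also have "\<dots> \<le> 3 ^ n"
    using sum_half_power_abs_le[of N] by (auto intro!: power_mono sum_nonneg)
  finally have "real (card G) \<le> 3 ^ n * 2 powr (real n * B)"
    by (simp add: powr_divide field_simps)
  also have "\<dots> = K ^ n"
    by (simp add: K_def power_mult_distrib powr_realpow[symmetric] powr_powr mult.commute)
  finally have cardG: "real (card G) \<le> K ^ n" .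
  have finG: "finite G"
    unfolding G_def by (rule finite_subset[of _ "{..<n} \<rightarrow>\<^sub>E {- int N..int N}"]) (auto intro!: finite_PiE)
  define f :: "(nat \<Rightarrow> int) \<Rightarrow> nat \<Rightarrow> real"
    where "f z = (\<lambda>i. r * z i / L2_set (\<lambda>i. r * z i) {..<n})" for z
  \<comment> \<open>Division by zero sends the zero lattice point to the zero vector; the condition
    on the norm removes it.\<close>
  define T where "T = {x \<in> f ` G. L2_set x {..<n} = 1}"
  have "\<exists>x\<in>T. L2_set (\<lambda>i. u i - x i) {..<n} \<le> \<epsilon>" if u: "L2_set u {..<n} = 1" for u
  proof -
    define z where "z = (\<lambda>i\<in>{..<n}. \<lfloor>u i / r\<rfloor>)"
    let ?w = "\<lambda>i. r * real_of_int (z i)"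
    let ?W = "L2_set ?w {..<n}"
    have close: "\<bar>u i - ?w i\<bar> \<le> r" if "i < n" for i
    proof -
      have "u i / r - 1 \<le> z i" "z i \<le> u i / r"
        using that by (auto simp: z_def)
      then show ?thesis
        using r by (auto simp: field_simps abs_le_iff)
    qed
    have "(\<Sum>i<n. (u i - ?w i)\<^sup>2) \<le> (\<Sum>i<n. r\<^sup>2)"
    proof (rule sum_mono)
      fix i assume "i \<in> {..<n}"
      then show "(u i - ?w i)\<^sup>2 \<le> r\<^sup>2"
        using power_mono[OF close, of i 2] by simp
    qed
    then have "(L2_set (\<lambda>i. u i - ?w i) {..<n})\<^sup>2 \<le> \<delta>\<^sup>2"
      using r by (simp add: L2_set_power2 mult.commute)
    then have uw: "L2_set (\<lambda>i. u i - ?w i) {..<n} \<le> \<delta>"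
      using \<delta> by (simp add: power2_le_iff_abs_le)
    have W_le: "?W \<le> 1 + \<delta>"
      using L2_set_triangle_diff[of ?w "{..<n}" u] uw u L2_set_diff_commute[of u ?w "{..<n}"] by simp
    have W_ge: "?W \<ge> 1 - \<delta>"
      using L2_set_triangle_diff[of u "{..<n}" ?w] uw u by simp
    have Wpos: "?W > 0" using W_ge \<delta> by linarith
    have "r\<^sup>2 * (\<Sum>i<n. (real_of_int (z i))\<^sup>2) = ?W\<^sup>2"
      by (simp add: L2_set_power2 sum_distrib_left power_mult_distrib)
    also have "\<dots> \<le> 2\<^sup>2"
      using W_le \<delta> Wpos by (intro power_mono) auto
    finally have sq: "(\<Sum>i<n. (real_of_int (z i))\<^sup>2) \<le> 4 / r\<^sup>2"
      using r by (simp add: field_simps)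
    have "real (\<Sum>i<n. nat \<bar>z i\<bar>) = (\<Sum>i<n. \<bar>real_of_int (z i)\<bar>)"
      by simp
    also have "\<dots> \<le> (\<Sum>i<n. (1 + (real_of_int (z i))\<^sup>2) / 2)"
    proof (rule sum_mono)
      fix i
      have "0 \<le> (\<bar>real_of_int (z i)\<bar> - 1)\<^sup>2" by simp
      then show "\<bar>real_of_int (z i)\<bar> \<le> (1 + (real_of_int (z i))\<^sup>2) / 2"
        by (simp add: power2_eq_square algebra_simps)
    qed
    also have "\<dots> = (real n + (\<Sum>i<n. (real_of_int (z i))\<^sup>2)) / 2"
      by (simp add: sum.distrib flip: sum_divide_distrib)
    also have "\<dots> \<le> (real n + 4 / r\<^sup>2) / 2"
      using sq by simp
    also have "\<dots> = real n * B"
    proof -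
      have "4 / r\<^sup>2 = real n * (4 / \<delta>\<^sup>2)"
        using r \<delta> n by (simp add: r(2)[symmetric])
      then show ?thesis by (simp add: B_def algebra_simps)
    qed
    finally have l1: "real (\<Sum>i<n. nat \<bar>z i\<bar>) \<le> real n * B" .
    have "z i \<in> {- int N..int N}" if "i < n" for i
    proof -
      have "nat \<bar>z i\<bar> \<le> (\<Sum>i<n. nat \<bar>z i\<bar>)"
        using that by (intro member_le_sum) auto
      also have "\<dots> \<le> N"
        using l1 unfolding N_def by linarith
      finally show ?thesis by auto
    qed
    then have "z \<in> G"
      using l1 by (auto simp: G_def z_def)
    moreover have "L2_set (f z) {..<n} = 1"
    proof -
      have "L2_set (f z) {..<n} = L2_set (\<lambda>i. (1 / ?W) * ?w i) {..<n}"
        by (simp add: f_def)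
      also have "\<dots> = (1 / ?W) * ?W"
        by (rule L2_set_right_distrib[symmetric]) simp
      finally show ?thesis using Wpos by simp
    qed
    ultimately have "f z \<in> T"
      by (auto simp: T_def)
    \<comment> \<open>Normalising moves \<open>?w\<close> along its own ray, by
      \<open>\<bar>?W - 1\<bar>\<close>.\<close>
    moreover have "L2_set (\<lambda>i. u i - f z i) {..<n} \<le> \<epsilon>"
    proof -
      have "L2_set (\<lambda>i. ?w i - f z i) {..<n} = L2_set (\<lambda>i. (1 - 1 / ?W) * ?w i) {..<n}"
        by (simp add: f_def algebra_simps)
      also have "\<dots> = \<bar>1 - 1 / ?W\<bar> * ?W"
        by (simp add: L2_set_def power_mult_distrib real_sqrt_mult flip: sum_distrib_left)
      also have "\<dots> = \<bar>?W - 1\<bar>"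
        using Wpos by (simp add: abs_mult[symmetric] field_simps flip: abs_of_pos)
      also have "\<dots> \<le> \<delta>"
        using W_le W_ge by linarith
      finally have "L2_set (\<lambda>i. ?w i - f z i) {..<n} \<le> \<delta>" .
      moreover have "L2_set (\<lambda>i. u i - f z i) {..<n} \<le>
          L2_set (\<lambda>i. u i - ?w i) {..<n} + L2_set (\<lambda>i. ?w i - f z i) {..<n}"
        using L2_set_triangle_ineq[of "\<lambda>i. u i - ?w i" "\<lambda>i. ?w i - f z i" "{..<n}"] by simp
      ultimately show ?thesis
        using uw by (simp add: \<delta>_def)
    qed
    ultimately show ?thesis by blast
  qed
  moreover have "real (card T) \<le> K ^ n"
  proof -
    have "card T \<le> card (f ` G)"
      unfolding T_def using finG by (intro card_mono) auto
    also have "\<dots> \<le> card G"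
      using finG by (rule card_image_le)
    finally show ?thesis using cardG by simp
  qed
  moreover have "finite T" using finG by (simp add: T_def)
  moreover have "\<forall>x\<in>T. L2_set x {..<n} = 1" by (simp add: T_def)
  ultimately show "\<exists>T. finite T \<and> real (card T) \<le> K ^ n \<and> (\<forall>x\<in>T. L2_set x {..<n} = 1) \<and>
        (\<forall>u. L2_set u {..<n} = 1 \<longrightarrow> (\<exists>x\<in>T. L2_set (\<lambda>i. u i - x i) {..<n} \<le> \<epsilon>))"
    by blast
qed

section \<open>Sparse approximation of convex combinations\<close>

text \<open>
  Maurey's empirical method, derandomised: the next atom is chosen so that the squared error
  does not exceed its average under the weights \<open>y\<close>.
\<close>

lemma maurey:
  fixes b :: "nat \<Rightarrow> 'j \<Rightarrow> real"
  assumes J: "finite J" and y: "\<And>i. i < m \<Longrightarrow> 0 \<le> y i" "(\<Sum>i<m. y i) = 1"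
    and b: "\<And>i. i < m \<Longrightarrow> (\<Sum>j\<in>J. (b i j)\<^sup>2) \<le> R"
  shows "\<exists>z :: nat \<Rightarrow> nat. (\<Sum>i<m. z i) = k \<and>
    (\<Sum>j\<in>J. ((\<Sum>i<m. real (z i) * b i j) - real k * (\<Sum>i<m. y i * b i j))\<^sup>2) \<le> real k * R"
proof (induction k)
  case 0
  show ?case by (rule exI[of _ "\<lambda>_. 0"]) auto
next
  case (Suc k)
  define a where "a j = (\<Sum>i<m. y i * b i j)" for j
  from Suc obtain z where z: "(\<Sum>i<m. z i) = k"
    and zR: "(\<Sum>j\<in>J. ((\<Sum>i<m. real (z i) * b i j) - real k * a j)\<^sup>2) \<le> real k * R"
    by (auto simp: a_def)
  \<comment> \<open>\<open>S\<close> is the current error and \<open>D i\<close> the squared error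
    after adding atom \<open>i\<close>.\<close>
  define S where "S j = (\<Sum>i<m. real (z i) * b i j) - real k * a j" for j
  define D where "D i = (\<Sum>j\<in>J. (S j + b i j - a j)\<^sup>2)" for i
  \<comment> \<open>Under the weights \<open>y\<close> the vectors \<open>b i - a\<close> have mean
    zero, so their cross terms with \<open>S\<close> vanish and each step adds at most the variance,
    which is at most \<open>R\<close>.\<close>
  have avg: "(\<Sum>i<m. y i * D i) \<le> real (Suc k) * R"
  proof -
    have "(\<Sum>i<m. y i * D i) = (\<Sum>j\<in>J. \<Sum>i<m. y i * (S j + b i j - a j)\<^sup>2)"
      unfolding D_def sum_distrib_left by (rule sum.swap)
    also have "\<dots> \<le> (\<Sum>j\<in>J. (S j)\<^sup>2 + (\<Sum>i<m. y i * (b i j)\<^sup>2))"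
    proof (rule sum_mono)
      fix j
      have "(\<Sum>i<m. y i * (S j + b i j - a j)\<^sup>2) =
          (\<Sum>i<m. (S j - a j)\<^sup>2 * y i + 2 * (S j - a j) * (y i * b i j) + y i * (b i j)\<^sup>2)"
        by (intro sum.cong refl) (simp add: power2_eq_square algebra_simps)
      also have "\<dots> = (S j - a j)\<^sup>2 * (\<Sum>i<m. y i) + 2 * (S j - a j) * a j + (\<Sum>i<m. y i * (b i j)\<^sup>2)"
        by (simp add: sum.distrib sum_distrib_left a_def)
      also have "\<dots> = (S j)\<^sup>2 - (a j)\<^sup>2 + (\<Sum>i<m. y i * (b i j)\<^sup>2)"
        using y by (simp add: power2_eq_square algebra_simps)
      finally show "(\<Sum>i<m. y i * (S j + b i j - a j)\<^sup>2) \<le> (S j)\<^sup>2 + (\<Sum>i<m. y i * (b i j)\<^sup>2)"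
        by simp
    qed
    also have "\<dots> = (\<Sum>j\<in>J. (S j)\<^sup>2) + (\<Sum>i<m. y i * (\<Sum>j\<in>J. (b i j)\<^sup>2))"
      unfolding sum_distrib_left sum.distrib by (subst sum.swap) simp
    also have "\<dots> \<le> real k * R + (\<Sum>i<m. y i * R)"
      using zR y b by (intro add_mono sum_mono mult_left_mono) (auto simp: S_def)
    also have "\<dots> = real (Suc k) * R"
      using y by (simp add: distrib_right flip: sum_distrib_right)
    finally show ?thesis .
  qed
  have "\<exists>i<m. D i \<le> real (Suc k) * R"
  proof (rule ccontr)
    assume "\<not> ?thesis"
    then have less: "real (Suc k) * R < D i" if "i < m" for i
      using that by force
    \<comment> \<open>An atom of positive weight makes the comparison of the two averages
      strict.\<close>
    have "\<exists>i<m. y i > 0"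
    proof (rule ccontr)
      assume "\<not> ?thesis"
      then have "(\<Sum>i<m. y i) \<le> (\<Sum>i<m. 0)"
        by (intro sum_mono) force
      then show False using y by simp
    qed
    then obtain i0 where i0: "i0 < m" "y i0 > 0" by blast
    have "(\<Sum>i<m. y i * (real (Suc k) * R)) < (\<Sum>i<m. y i * D i)"
    proof (rule sum_strict_mono_ex1)
      show "\<forall>i\<in>{..<m}. y i * (real (Suc k) * R) \<le> y i * D i"
        using y by (intro ballI mult_left_mono less_imp_le[OF less]) auto
      show "\<exists>i\<in>{..<m}. y i * (real (Suc k) * R) < y i * D i"
        using less[OF i0(1)] i0 by (intro bexI[of _ i0]) auto
    qed auto
    then show False
      using avg y by (simp flip: sum_distrib_right)
  qed
  then obtain i0 where i0: "i0 < m" "D i0 \<le> real (Suc k) * R" by blast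
  define z' where "z' = z(i0 := Suc (z i0))"
  have upd: "(\<Sum>i<m. real (z' i) * g i) = (\<Sum>i<m. real (z i) * g i) + g i0" for g :: "nat \<Rightarrow> real"
  proof -
    have "(\<Sum>i<m. real (z' i) * g i) = (\<Sum>i<m. real (z i) * g i + (if i = i0 then g i else 0))"
      by (intro sum.cong) (auto simp: z'_def algebra_simps)
    also have "\<dots> = (\<Sum>i<m. real (z i) * g i) + g i0"
      using i0(1) by (simp add: sum.distrib)
    finally show ?thesis .
  qed
  have "real (\<Sum>i<m. z' i) = real (Suc k)"
    using upd[of "\<lambda>_. 1"] z[symmetric] by simp
  then have 1: "(\<Sum>i<m. z' i) = Suc k" by linarith
  have "(\<Sum>j\<in>J. ((\<Sum>i<m. real (z' i) * b i j) - real (Suc k) * a j)\<^sup>2) = D i0"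
    unfolding D_def upd by (intro sum.cong) (auto simp: S_def algebra_simps)
  with 1 i0 show ?case
    unfolding a_def by (intro exI[of _ z']) auto
qed

section \<open>Convex duality for the polyhedron\<close>

lemma exists_nearest_subconvex_combination:
  fixes a :: "nat \<Rightarrow> nat \<Rightarrow> real" and p :: "nat \<Rightarrow> real"
  shows "\<exists>y. (\<forall>i. 0 \<le> y i) \<and> (\<Sum>i<m. y i) \<le> 1 \<and>
    (\<forall>y'. (\<forall>i<m. 0 \<le> y' i) \<longrightarrow> (\<Sum>i<m. y' i) \<le> 1 \<longrightarrow>
      (\<Sum>j<n. (p j - (\<Sum>i<m. y i * a i j))\<^sup>2) \<le> (\<Sum>j<n. (p j - (\<Sum>i<m. y' i * a i j))\<^sup>2))"
proof -
  define F where "F y = (\<Sum>j<n. (p j - (\<Sum>i<m. y i * a i j))\<^sup>2)" for y :: "nat \<Rightarrow> real"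
  \<comment> \<open>Weights are functions on all of \<open>nat\<close>, fixed to 0 from
    \<open>m\<close> on, so that Tychonoff's theorem gives compactness and a continuous function
    attains its minimum.\<close>
  define C :: "(nat \<Rightarrow> real) set" where "C = PiE UNIV (\<lambda>i. if i < m then {0..1} else {0})"
  define S where "S = C \<inter> {y. (\<Sum>i<m. y i) \<le> 1}"
  have "compactin (product_topology (\<lambda>i. euclidean) UNIV) C"
    unfolding C_def by (subst compactin_PiE) auto
  then have "compact C"
    by (simp add: euclidean_product_topology)
  moreover have "closed {y :: nat \<Rightarrow> real. (\<Sum>i<m. y i) \<le> 1}"
    by (intro closed_Collect_le continuous_intros continuous_on_product_coordinates)
  ultimately have "compact S"
    unfolding S_def by (rule compact_Int_closed)
  moreover have "(\<lambda>_. 0) \<in> S"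
    by (auto simp: S_def C_def)
  moreover have "continuous_on S F"
    unfolding F_def
    by (intro continuous_intros continuous_on_subset[OF continuous_on_product_coordinates]) auto
  ultimately obtain y where y: "y \<in> S" "\<And>y'. y' \<in> S \<Longrightarrow> F y \<le> F y'"
    using continuous_attains_inf[of S F] by blast
  show ?thesis
  proof (intro exI[of _ y] conjI allI impI)
    show "0 \<le> y i" for i
      using y(1) by (auto simp: S_def C_def PiE_iff split: if_splits dest: spec[of _ i])
    show "(\<Sum>i<m. y i) \<le> 1"
      using y by (auto simp: S_def)
    fix y' :: "nat \<Rightarrow> real"
    assume y': "\<forall>i<m. 0 \<le> y' i" "(\<Sum>i<m. y' i) \<le> 1"
    define y'' where "y'' i = (if i < m then y' i else 0)" for i
    have "y' i \<le> 1" if "i < m" for i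
    proof -
      have "y' i \<le> (\<Sum>i<m. y' i)"
        using that y' by (intro member_le_sum) auto
      with y' show ?thesis by simp
    qed
    then have "y'' \<in> S"
      using y' by (auto simp: S_def C_def y''_def)
    then have "F y \<le> F y''" by (rule y)
    also have "F y'' = F y'"
      by (simp add: F_def y''_def)
    finally show "(\<Sum>j<n. (p j - (\<Sum>i<m. y i * a i j))\<^sup>2) \<le> (\<Sum>j<n. (p j - (\<Sum>i<m. y' i * a i j))\<^sup>2)"
      by (simp add: F_def)
  qed
qed

text \<open>First-order optimality: the hypothesis is the change of a squared distance along a
  segment, divided by the step length \<open>s\<close>; letting \<open>s\<close> tend to 0 leaves
  the linear term.\<close>

lemma nonpos_of_quadratic_perturbation:
  fixes \<alpha> \<beta> :: real
  assumes "\<And>s. 0 < s \<Longrightarrow> s \<le> 1 \<Longrightarrow> 0 \<le> s * \<beta> - 2 * \<alpha>"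
  shows "\<alpha> \<le> 0"
proof (rule ccontr)
  assume "\<not> \<alpha> \<le> 0"
  \<comment> \<open>Chosen so that \<open>s * \<beta>\<close> is at most \<open>\<alpha>\<close>,
    which is incompatible with \<open>2 * \<alpha>\<close> being at most
    \<open>s * \<beta>\<close>.\<close>
  define s where "s = min 1 (\<alpha> / (1 + \<bar>\<beta>\<bar>))"
  have s: "0 < s" "s \<le> 1" "s \<le> \<alpha> / (1 + \<bar>\<beta>\<bar>)"
    using \<open>\<not> \<alpha> \<le> 0\<close> by (auto simp: s_def)
  have "s * (1 + \<bar>\<beta>\<bar>) \<le> \<alpha>"
    using s(3) by (simp add: pos_le_divide_eq)
  have "s * \<beta> \<le> s * (1 + \<bar>\<beta>\<bar>)"
    using s by (intro mult_left_mono) auto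
  then show False
    using assms[OF s(1,2)] \<open>s * (1 + \<bar>\<beta>\<bar>) \<le> \<alpha>\<close> \<open>\<not> \<alpha> \<le> 0\<close> by linarith
qed

text \<open>Linear programming duality, by separating \<open>\<mu> c\<close> from the convex hull of the rows and the origin.\<close>

lemma polyhedron_duality:
  fixes a :: "nat \<Rightarrow> nat \<Rightarrow> real"
  assumes \<mu>: "0 < \<mu>"
    and no: "\<And>y. (\<And>i. i < m \<Longrightarrow> 0 \<le> y i) \<Longrightarrow> (\<Sum>i<m. y i) \<le> 1 \<Longrightarrow>
        (\<And>j. j < n \<Longrightarrow> (\<Sum>i<m. y i * a i j) = \<mu> * c j) \<Longrightarrow> False"
  shows "ereal (1 / \<mu>) \<le> support_function n (polyhedron_of m n a) c"
proof -
  obtain y where y: "\<And>i. 0 \<le> y i" "(\<Sum>i<m. y i) \<le> 1"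
    and opt: "\<And>y'. (\<And>i. i < m \<Longrightarrow> 0 \<le> y' i) \<Longrightarrow> (\<Sum>i<m. y' i) \<le> 1 \<Longrightarrow>
      (\<Sum>j<n. (\<mu> * c j - (\<Sum>i<m. y i * a i j))\<^sup>2) \<le> (\<Sum>j<n. (\<mu> * c j - (\<Sum>i<m. y' i * a i j))\<^sup>2)"
    using exists_nearest_subconvex_combination[where p = "\<lambda>j. \<mu> * c j" and a = a and n = n and m = m]
    by blast
  define q where "q j = (\<Sum>i<m. y i * a i j)" for j
  define d where "d j = \<mu> * c j - q j" for j
  \<comment> \<open>Variational inequality at the nearest point \<open>q\<close>: a small move
    towards another subconvex combination \<open>v\<close> cannot shorten the distance to
    \<open>\<mu> c\<close>.\<close>
  have key: "(\<Sum>j<n. d j * (v j - q j)) \<le> 0"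
    if v: "\<And>j. v j = (\<Sum>i<m. x i * a i j)" and x: "\<And>i. i < m \<Longrightarrow> 0 \<le> x i" "(\<Sum>i<m. x i) \<le> 1" for v x
  proof (rule nonpos_of_quadratic_perturbation)
    fix s :: real assume s: "0 < s" "s \<le> 1"
    define y' where "y' i = (1 - s) * y i + s * x i" for i
    have "(\<Sum>i<m. y' i) = (1 - s) * (\<Sum>i<m. y i) + s * (\<Sum>i<m. x i)"
      by (simp add: y'_def sum.distrib sum_distrib_left)
    also have "\<dots> \<le> (1 - s) * 1 + s * 1"
      using s y x by (intro add_mono mult_left_mono) auto
    finally have "(\<Sum>i<m. y' i) \<le> 1" by simp
    then have "(\<Sum>j<n. (d j)\<^sup>2) \<le> (\<Sum>j<n. (\<mu> * c j - (\<Sum>i<m. y' i * a i j))\<^sup>2)"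
      using opt[of y'] s y x by (simp add: y'_def d_def q_def)
    also have "\<dots> = (\<Sum>j<n. (d j)\<^sup>2 + s * (s * (v j - q j)\<^sup>2 - 2 * (d j * (v j - q j))))"
    proof (intro sum.cong refl)
      fix j
      have "(\<Sum>i<m. y' i * a i j) = q j + s * (v j - q j)"
        by (simp add: y'_def q_def v sum.distrib sum_distrib_left sum_subtractf algebra_simps)
      then have "\<mu> * c j - (\<Sum>i<m. y' i * a i j) = d j - s * (v j - q j)"
        by (simp add: d_def)
      then show "(\<mu> * c j - (\<Sum>i<m. y' i * a i j))\<^sup>2 =
          (d j)\<^sup>2 + s * (s * (v j - q j)\<^sup>2 - 2 * (d j * (v j - q j)))"
        by (simp only:) (simp add: power2_eq_square algebra_simps)
    qed
    also have "\<dots> = (\<Sum>j<n. (d j)\<^sup>2) +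
        s * (s * (\<Sum>j<n. (v j - q j)\<^sup>2) - 2 * (\<Sum>j<n. d j * (v j - q j)))"
      by (simp add: sum.distrib sum_subtractf flip: sum_distrib_left)
    finally have "0 \<le> s * (s * (\<Sum>j<n. (v j - q j)\<^sup>2) - 2 * (\<Sum>j<n. d j * (v j - q j)))"
      by simp
    then show "0 \<le> s * (\<Sum>j<n. (v j - q j)\<^sup>2) - 2 * (\<Sum>j<n. d j * (v j - q j))"
      using s by (simp add: zero_le_mult_iff)
  qed
  define dq dc where "dq = (\<Sum>j<n. d j * q j)" and "dc = (\<Sum>j<n. d j * c j)"
  \<comment> \<open>The origin is a subconvex combination, so it may be taken for
    \<open>v\<close>.\<close>
  have dq: "0 \<le> dq"
    using key[of "\<lambda>_. 0" "\<lambda>_. 0"] by (simp add: dq_def sum_negf)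
  have da: "(\<Sum>j<n. d j * a i j) \<le> dq" if "i < m" for i
  proof -
    have "(\<Sum>j<n. d j * (a i j - q j)) \<le> 0"
    proof (rule key[of "a i" "\<lambda>l. if l = i then 1 else 0"])
      show "a i j = (\<Sum>l<m. (if l = i then 1 else 0) * a l j)" for j
      proof -
        have "(\<Sum>l<m. (if l = i then 1 else 0) * a l j) = (\<Sum>l<m. if l = i then a l j else 0)"
          by (intro sum.cong) auto
        then show ?thesis using that by simp
      qed
    qed (use that in auto)
    then show ?thesis
      by (simp add: dq_def algebra_simps sum_subtractf)
  qed
  have "\<exists>j<n. d j \<noteq> 0"
  proof (rule ccontr)
    assume "\<not> ?thesis"
    then have "(\<Sum>i<m. y i * a i j) = \<mu> * c j" if "j < n" for j
      using that by (auto simp: d_def q_def)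
    with no[of y] y show False by blast
  qed
  \<comment> \<open>Pairing \<open>d\<close> with itself, that is with \<open>\<mu> c - q\<close>,
    turns \<open>d\<close> being nonzero into strict separation.\<close>
  then have "(\<Sum>j<n. (d j)\<^sup>2) > 0"
    by (auto intro!: sum_pos2)
  also have "(\<Sum>j<n. (d j)\<^sup>2) = \<mu> * dc - dq"
    by (simp add: dc_def dq_def d_def power2_eq_square sum_distrib_left sum_subtractf sum.distrib algebra_simps)
  finally have less: "dq < \<mu> * dc" by simp
  have "0 < \<mu> * dc" using less dq by linarith
  \<comment> \<open>The separating direction, scaled so that its pairing with \<open>c\<close> is
    \<open>1 / \<mu>\<close>; its pairings with the rows are then at most
    \<open>dq / (\<mu> * dc)\<close>, below 1.\<close>
  define x where "x = (\<lambda>j\<in>{..<n}. d j / (\<mu> * dc))"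
  have "(\<Sum>j<n. a i j * x j) \<le> 1" if "i < m" for i
  proof -
    have "(\<Sum>j<n. a i j * x j) = (\<Sum>j<n. d j * a i j) / (\<mu> * dc)"
      by (simp add: x_def sum_divide_distrib mult.commute)
    also have "\<dots> \<le> 1"
      using da[OF that] less \<open>0 < \<mu> * dc\<close> by (simp add: divide_le_eq)
    finally show ?thesis .
  qed
  then have xP: "x \<in> polyhedron_of m n a"
    by (auto simp: polyhedron_of_def x_def)
  have "inner_prod n c x = dc / (\<mu> * dc)"
    by (simp add: inner_prod_def x_def dc_def sum_divide_distrib mult.commute)
  also have "\<dots> = 1 / \<mu>"
    using \<open>0 < \<mu> * dc\<close> by auto
  finally show ?thesis
    unfolding support_function_def using SUP_upper[OF xP, of "\<lambda>x. ereal (inner_prod n c x)"] by simp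
qed

section \<open>Gaussian vectors and matrices\<close>

context prob_space
begin

lemma indep_vars_blocks:
  fixes X :: "'i \<Rightarrow> 'a \<Rightarrow> real"
  assumes "indep_vars (\<lambda>_. borel) X I" "\<And>l. l \<in> L \<Longrightarrow> K l \<subseteq> I" "disjoint_family_on K L"
    and "\<And>l. l \<in> L \<Longrightarrow> f l \<in> borel_measurable (\<Pi>\<^sub>M p\<in>K l. borel)"
  shows "indep_vars (\<lambda>_. borel) (\<lambda>l \<omega>. f l (\<lambda>p\<in>K l. X p \<omega>)) L"
  by (rule indep_vars_compose2[OF indep_vars_restrict[OF assms(1-3)] assms(4)])

text \<open>Exponential Markov inequality and factorisation by independence. The usual free
  parameter is absorbed into the scaling of \<open>Y\<close>.\<close>

lemma chernoff_sum:
  fixes Y :: "'i \<Rightarrow> 'a \<Rightarrow> real"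
  assumes fin: "finite I" and indep: "indep_vars (\<lambda>_. borel) Y I"
    and B: "\<And>i. i \<in> I \<Longrightarrow> (\<integral>\<^sup>+\<omega>. ennreal (exp (Y i \<omega>)) \<partial>M) \<le> ennreal B" "0 \<le> B"
  shows "prob {\<omega>\<in>space M. a \<le> (\<Sum>i\<in>I. Y i \<omega>)} \<le> exp (- a) * B ^ card I"
proof -
  have [measurable]: "Y i \<in> borel_measurable M" if "i \<in> I" for i
    using indep that by (auto simp: indep_vars_def)
  let ?S = "{\<omega>\<in>space M. a \<le> (\<Sum>i\<in>I. Y i \<omega>)}"
  have S: "?S \<in> events"
    by measurable
  have exp_indep: "indep_vars (\<lambda>_. borel) (\<lambda>i \<omega>. ennreal (exp (Y i \<omega>))) I"
    by (rule indep_vars_compose2[OF indep]) measurable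
  have "emeasure M ?S = (\<integral>\<^sup>+\<omega>. indicator ?S \<omega> \<partial>M)"
    using S by simp
  also have "\<dots> \<le> (\<integral>\<^sup>+\<omega>. ennreal (exp (- a)) * (\<Prod>i\<in>I. ennreal (exp (Y i \<omega>))) \<partial>M)"
  proof (rule nn_integral_mono)
    fix \<omega>
    have "ennreal (exp (- a)) * (\<Prod>i\<in>I. ennreal (exp (Y i \<omega>))) = ennreal (exp ((\<Sum>i\<in>I. Y i \<omega>) - a))"
      using fin by (simp add: prod_ennreal exp_sum[symmetric] exp_diff exp_minus field_simps flip: ennreal_mult)
    then show "indicator ?S \<omega> \<le> ennreal (exp (- a)) * (\<Prod>i\<in>I. ennreal (exp (Y i \<omega>)))"
      by (auto simp: indicator_def)
  qed
  also have "\<dots> = ennreal (exp (- a)) * (\<integral>\<^sup>+\<omega>. (\<Prod>i\<in>I. ennreal (exp (Y i \<omega>))) \<partial>M)"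
    by (rule nn_integral_cmult) measurable
  also have "(\<integral>\<^sup>+\<omega>. (\<Prod>i\<in>I. ennreal (exp (Y i \<omega>))) \<partial>M) = (\<Prod>i\<in>I. \<integral>\<^sup>+\<omega>. ennreal (exp (Y i \<omega>)) \<partial>M)"
    by (rule indep_vars_nn_integral[OF fin exp_indep]) simp
  also have "ennreal (exp (- a)) * \<dots> \<le> ennreal (exp (- a)) * (\<Prod>i\<in>I. ennreal B)"
    by (intro mult_left_mono prod_mono_ennreal B) auto
  also have "\<dots> = ennreal (exp (- a) * B ^ card I)"
    using B by (simp add: ennreal_mult ennreal_power)
  finally show ?thesis
    using B by (simp add: emeasure_eq_measure)
qed

lemma std_normal_combination:
  fixes X :: "'i \<Rightarrow> 'a \<Rightarrow> real"
  assumes fin: "finite I" and indep: "indep_vars (\<lambda>_. borel) X I"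
    and X: "\<And>i. i \<in> I \<Longrightarrow> distributed M lborel (X i) std_normal_density"
    and w: "(\<Sum>i\<in>I. (w i)\<^sup>2) = 1"
  shows "distributed M lborel (\<lambda>\<omega>. \<Sum>i\<in>I. w i * X i \<omega>) std_normal_density"
proof -
  \<comment> \<open>Zero coefficients are dropped because \<open>sum_indep_normal\<close> asks for
    positive standard deviations.\<close>
  define J where "J = {i \<in> I. w i \<noteq> 0}"
  have J: "finite J" "J \<subseteq> I"
    using fin by (auto simp: J_def)
  have "(\<Sum>i\<in>I. (w i)\<^sup>2) = (\<Sum>i\<in>J. (w i)\<^sup>2)"
    using fin by (intro sum.mono_neutral_right) (auto simp: J_def)
  with w have wJ: "(\<Sum>i\<in>J. (w i)\<^sup>2) = 1"
    by simp
  have sum_J: "(\<Sum>i\<in>I. w i * X i \<omega>) = (\<Sum>i\<in>J. w i * X i \<omega>)" for \<omega>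
    using fin by (intro sum.mono_neutral_right) (auto simp: J_def)
  have "distributed M lborel (\<lambda>\<omega>. \<Sum>i\<in>J. w i * X i \<omega>)
      (normal_density (\<Sum>i\<in>J. 0) (sqrt (\<Sum>i\<in>J. \<bar>w i\<bar>\<^sup>2)))"
  proof (rule sum_indep_normal)
    show "J \<noteq> {}" using wJ by auto
    show "indep_vars (\<lambda>_. borel) (\<lambda>i \<omega>. w i * X i \<omega>) J"
      by (rule indep_vars_compose2[OF indep_vars_subset[OF indep J(2)]]) measurable
    fix i assume "i \<in> J"
    then show "0 < \<bar>w i\<bar>" by (simp add: J_def)
    show "distributed M lborel (\<lambda>\<omega>. w i * X i \<omega>) (normal_density 0 \<bar>w i\<bar>)"
      using normal_density_affine[of "X i" 0 1 "w i" 0] X \<open>i \<in> J\<close> by (simp add: J_def)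
  qed (use J in auto)
  then show ?thesis
    by (simp add: wJ sum_J)
qed

context
  fixes X :: "'a \<Rightarrow> real"
  assumes X: "distributed M lborel X std_normal_density"
begin

lemma std_normal_measurable [measurable]: "X \<in> borel_measurable M"
  using distributed_measurable[OF X] by simp

text \<open>Completing the square bounds a tilted Gaussian density by a multiple of another normal
  density, whose integral is 1. The term with \<open>c\<close> allows for a region where
  \<open>f\<close> equals 1.\<close>

lemma nn_integral_std_normal_le:
  assumes [measurable]: "f \<in> borel_measurable borel" and f: "\<And>x. 0 \<le> f x"
    and c: "0 \<le> c" "0 \<le> d" "0 < \<sigma>"
    and le: "\<And>x. std_normal_density x * f x \<le> c * std_normal_density x + d * normal_density \<mu> \<sigma> x"
  shows "(\<integral>\<^sup>+\<omega>. ennreal (f (X \<omega>)) \<partial>M) \<le> ennreal (c + d)"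
proof -
  have normal: "(\<integral>\<^sup>+x. ennreal (normal_density \<mu> \<sigma> x) \<partial>lborel) = 1" if "0 < \<sigma>" for \<mu> \<sigma>
  proof -
    interpret N: prob_space "density lborel (normal_density \<mu> \<sigma>)"
      by (rule prob_space_normal_density[OF that])
    show ?thesis
      using N.emeasure_space_1 by (simp add: emeasure_density)
  qed
  have "(\<integral>\<^sup>+\<omega>. ennreal (f (X \<omega>)) \<partial>M) = (\<integral>\<^sup>+x. ennreal (std_normal_density x) * ennreal (f x) \<partial>lborel)"
    by (rule distributed_nn_integral[OF X, symmetric]) measurable
  also have "\<dots> \<le> (\<integral>\<^sup>+x. ennreal c * ennreal (std_normal_density x) + ennreal d * ennreal (normal_density \<mu> \<sigma> x) \<partial>lborel)"
    using le c f by (intro nn_integral_mono) (simp flip: ennreal_mult ennreal_plus)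
  also have "\<dots> = ennreal c + ennreal d"
    using normal[OF c(3)] normal[of 1 0] by (simp add: nn_integral_add nn_integral_cmult)
  finally show ?thesis
    using c by simp
qed

lemma std_normal_exp_linear: "(\<integral>\<^sup>+\<omega>. ennreal (exp (a * X \<omega>)) \<partial>M) \<le> ennreal (exp (a\<^sup>2 / 2))"
proof -
  have "std_normal_density x * exp (a * x) = exp (a\<^sup>2 / 2) * normal_density a 1 x" for x
    by (simp add: normal_density_def flip: exp_add) (simp add: power2_eq_square field_simps)
  then show ?thesis
    using nn_integral_std_normal_le[of "\<lambda>x. exp (a * x)" 0 "exp (a\<^sup>2 / 2)" 1 a] by simp
qed

lemma std_normal_exp_square_quarter:
  "(\<integral>\<^sup>+\<omega>. ennreal (exp ((X \<omega>)\<^sup>2 / 4)) \<partial>M) \<le> ennreal (sqrt 2)"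
proof -
  have "std_normal_density x * exp (x\<^sup>2 / 4) = sqrt 2 * normal_density 0 (sqrt 2) x" for x
    by (simp add: normal_density_def real_sqrt_mult field_simps flip: exp_add)
  then show ?thesis
    using nn_integral_std_normal_le[of "\<lambda>x. exp (x\<^sup>2 / 4)" 0 "sqrt 2" "sqrt 2" 0] by simp
qed

text \<open>The inverse variance becomes 1 + 2 * 30 = 61. The factor 30 is large enough for
  \<open>1 / sqrt 61\<close> to lie below \<open>exp (- 2)\<close>.\<close>

lemma std_normal_exp_neg_square:
  "(\<integral>\<^sup>+\<omega>. ennreal (exp (- 30 * (X \<omega>)\<^sup>2)) \<partial>M) \<le> ennreal (1 / sqrt 61)"
proof -
  have "std_normal_density x * exp (- 30 * x\<^sup>2) = 1 / sqrt 61 * normal_density 0 (1 / sqrt 61) x" for x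
    by (simp add: normal_density_def real_sqrt_mult real_sqrt_divide field_simps flip: exp_add)
  then show ?thesis
    using nn_integral_std_normal_le[of "\<lambda>x. exp (- 30 * x\<^sup>2)" 0 "1 / sqrt 61" "1 / sqrt 61" 0] by simp
qed

lemma std_normal_exp_excess_square:
  assumes "0 \<le> \<tau>"
  shows "(\<integral>\<^sup>+\<omega>. ennreal (exp ((max 0 (X \<omega> - \<tau>))\<^sup>2 / 4)) \<partial>M) \<le> ennreal (1 + sqrt 2 * exp (- \<tau>\<^sup>2 / 2))"
proof -
  let ?f = "\<lambda>x. exp ((max 0 (x - \<tau>))\<^sup>2 / 4)"
  have "std_normal_density x * ?f x \<le>
      1 * std_normal_density x + (sqrt 2 * exp (- \<tau>\<^sup>2 / 2)) * normal_density \<tau> (sqrt 2) x" for x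
  proof (cases "x \<le> \<tau>")
    case True
    then show ?thesis by (simp add: max_def)
  next
    case False
    \<comment> \<open>Expanding around \<open>\<tau>\<close> leaves the cross term
      \<open>- \<tau> * (x - \<tau>)\<close>, which is nonpositive beyond \<open>\<tau>\<close>; the
      rest is a normal density of variance 2 centred at \<open>\<tau>\<close>, up to a
      factor.\<close>
    have "- x\<^sup>2 / 2 + (x - \<tau>)\<^sup>2 / 4 \<le> - \<tau>\<^sup>2 / 2 + (- (x - \<tau>)\<^sup>2 / 4)"
    proof -
      have "0 \<le> \<tau> * (x - \<tau>)" using False assms by auto
      moreover have "- x\<^sup>2 / 2 + (x - \<tau>)\<^sup>2 / 4 = - \<tau>\<^sup>2 / 2 + (- (x - \<tau>)\<^sup>2 / 4) - \<tau> * (x - \<tau>)"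
        by (simp add: power2_eq_square field_simps)
      ultimately show ?thesis by simp
    qed
    then have "exp (- x\<^sup>2 / 2) * exp ((x - \<tau>)\<^sup>2 / 4) \<le> exp (- \<tau>\<^sup>2 / 2) * exp (- (x - \<tau>)\<^sup>2 / 4)"
      by (simp flip: exp_add)
    then have "exp (- x\<^sup>2 / 2) * exp ((x - \<tau>)\<^sup>2 / 4) / sqrt (2 * pi) \<le>
        exp (- \<tau>\<^sup>2 / 2) * exp (- (x - \<tau>)\<^sup>2 / 4) / sqrt (2 * pi)"
      by (rule divide_right_mono) simp
    also have "exp (- x\<^sup>2 / 2) * exp ((x - \<tau>)\<^sup>2 / 4) / sqrt (2 * pi) = std_normal_density x * ?f x"
      using False by (simp add: std_normal_density_def max_def)
    also have "exp (- \<tau>\<^sup>2 / 2) * exp (- (x - \<tau>)\<^sup>2 / 4) / sqrt (2 * pi) =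
        (sqrt 2 * exp (- \<tau>\<^sup>2 / 2)) * normal_density \<tau> (sqrt 2) x"
      by (simp add: normal_density_def real_sqrt_mult field_simps)
    finally show ?thesis
      by (simp add: add_increasing)
  qed
  then show ?thesis
    using nn_integral_std_normal_le[of ?f 1 "sqrt 2 * exp (- \<tau>\<^sup>2 / 2)" "sqrt 2" \<tau>] by simp
qed

lemma std_normal_upper_tail:
  assumes "0 \<le> t"
  shows "prob {\<omega>\<in>space M. t < X \<omega>} \<le> exp (- t\<^sup>2 / 2)"
proof -
  let ?S = "{\<omega>\<in>space M. t < X \<omega>}"
  have S: "?S \<in> events" by measurable
  have "emeasure M ?S = (\<integral>\<^sup>+\<omega>. indicator ?S \<omega> \<partial>M)"
    using S by simp
  also have "\<dots> \<le> (\<integral>\<^sup>+\<omega>. ennreal (exp (- t\<^sup>2)) * ennreal (exp (t * X \<omega>)) \<partial>M)"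
  proof (rule nn_integral_mono)
    fix \<omega>
    have "t * t \<le> t * X \<omega>" if "\<omega> \<in> ?S"
      using that assms by (intro mult_left_mono) auto
    then show "indicator ?S \<omega> \<le> ennreal (exp (- t\<^sup>2)) * ennreal (exp (t * X \<omega>))"
      by (auto simp: indicator_def power2_eq_square simp flip: ennreal_mult exp_add)
  qed
  also have "\<dots> = ennreal (exp (- t\<^sup>2)) * (\<integral>\<^sup>+\<omega>. ennreal (exp (t * X \<omega>)) \<partial>M)"
    by (rule nn_integral_cmult) measurable
  also have "\<dots> \<le> ennreal (exp (- t\<^sup>2)) * ennreal (exp (t\<^sup>2 / 2))"
    by (intro mult_left_mono std_normal_exp_linear) auto
  also have "\<dots> = ennreal (exp (- t\<^sup>2 / 2))"
    by (simp flip: ennreal_mult exp_add)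
  finally show ?thesis
    by (simp add: emeasure_eq_measure)
qed

text \<open>The density decreases on \<open>{t..t + 1}\<close>, so its value at the right end bounds
  the mass of this interval. The shift by 1 is absorbed later by choosing \<open>t\<close> a factor
  \<open>1 - \<epsilon>\<close> below the critical level.\<close>

lemma std_normal_lower_tail:
  assumes "0 \<le> t"
  shows "exp (- (t + 1)\<^sup>2 / 2) / 3 \<le> prob {\<omega>\<in>space M. t \<le> X \<omega>}"
proof -
  let ?S = "{\<omega>\<in>space M. t \<le> X \<omega>}"
  have S: "?S \<in> events" by measurable
  have "ennreal (exp (- (t + 1)\<^sup>2 / 2) / 3) =
      (\<integral>\<^sup>+x. ennreal (exp (- (t + 1)\<^sup>2 / 2) / 3) * indicator {t..t + 1} x \<partial>lborel)"
    by (simp add: nn_integral_cmult_indicator)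
  also have "\<dots> \<le> (\<integral>\<^sup>+x. ennreal (std_normal_density x) * indicator {t..} x \<partial>lborel)"
  proof (rule nn_integral_mono)
    fix x :: real
    have "exp (- (t + 1)\<^sup>2 / 2) / 3 \<le> std_normal_density x" if "t \<le> x" "x \<le> t + 1"
    proof -
      have "x\<^sup>2 \<le> (t + 1)\<^sup>2"
        using that assms by (intro power_mono) auto
      moreover have "sqrt (2 * pi) \<le> 3"
        using pi_less_4 by (intro real_le_lsqrt) auto
      ultimately have "exp (- (t + 1)\<^sup>2 / 2) / 3 \<le> exp (- x\<^sup>2 / 2) / sqrt (2 * pi)"
        by (intro frac_le) auto
      then show ?thesis by (simp add: std_normal_density_def)
    qed
    then show "ennreal (exp (- (t + 1)\<^sup>2 / 2) / 3) * indicator {t..t + 1} x \<le>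
        ennreal (std_normal_density x) * indicator {t..} x"
      by (auto simp: indicator_def intro!: ennreal_leI)
  qed
  also have "\<dots> = (\<integral>\<^sup>+\<omega>. indicator {t..} (X \<omega>) \<partial>M)"
    by (rule distributed_nn_integral[OF X]) measurable
  also have "\<dots> = (\<integral>\<^sup>+\<omega>. indicator ?S \<omega> \<partial>M)"
    by (intro nn_integral_cong) (auto simp: indicator_def)
  also have "\<dots> = ennreal (prob ?S)"
    using S by (simp add: emeasure_eq_measure)
  finally show ?thesis
    by (simp add: ennreal_le_iff)
qed

end

end

section \<open>Linear forms of a Gaussian matrix of fixed size\<close>

locale gaussian_matrix = prob_space M for M :: "'a measure" +
  fixes m n :: nat and A :: "nat \<Rightarrow> nat \<Rightarrow> 'a \<Rightarrow> real"
  assumes indep: "indep_vars (\<lambda>_. borel) (\<lambda>(i, j). A i j) ({..<m} \<times> {..<n})"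
    and normal: "\<And>i j. i < m \<Longrightarrow> j < n \<Longrightarrow> distributed M lborel (A i j) std_normal_density"
begin

lemma measurable_entry [measurable (raw)]: "i < m \<Longrightarrow> j < n \<Longrightarrow> A i j \<in> borel_measurable M"
  by (rule std_normal_measurable[OF normal])

lemma measurable_row_form: "i < m \<Longrightarrow> (\<lambda>\<omega>. \<Sum>j<n. A i j \<omega> * x j) \<in> borel_measurable M"
  by (intro borel_measurable_sum borel_measurable_times) (auto intro: measurable_entry)

lemma indep_row: "i < m \<Longrightarrow> indep_vars (\<lambda>_. borel) (\<lambda>j. A i j) {..<n}"
  using indep_vars_blocks[OF indep, of "{..<n}" "\<lambda>j. {(i, j)}" "\<lambda>j g. g (i, j)"]
  by (simp add: disjoint_family_on_def)

lemma indep_column: "j < n \<Longrightarrow> indep_vars (\<lambda>_. borel) (\<lambda>i. A i j) {..<m}"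
  using indep_vars_blocks[OF indep, of "{..<m}" "\<lambda>i. {(i, j)}" "\<lambda>i g. g (i, j)"]
  by (simp add: disjoint_family_on_def)

text \<open>Two forms of the same row enter together because the sum of rows is tested in direction
  \<open>v\<close> but the rows are selected by direction \<open>x\<close>.\<close>

lemma indep_row_forms:
  assumes [measurable]: "(\<lambda>(s, t). h s t) \<in> borel_measurable (borel \<Otimes>\<^sub>M borel)"
  shows "indep_vars (\<lambda>_. borel) (\<lambda>i \<omega>. h (\<Sum>j<n. A i j \<omega> * x j) (\<Sum>j<n. A i j \<omega> * v j) :: real) {..<m}"
proof -
  have "indep_vars (\<lambda>_. borel) (\<lambda>i \<omega>. (\<lambda>g. h (\<Sum>j<n. g (i, j) * x j) (\<Sum>j<n. g (i, j) * v j))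
      (\<lambda>p\<in>{i} \<times> {..<n}. (case p of (i, j) \<Rightarrow> A i j) \<omega>)) {..<m}"
    by (rule indep_vars_blocks[OF indep]) (auto simp: disjoint_family_on_def)
  then show ?thesis by simp
qed

lemma indep_column_forms:
  assumes [measurable]: "h \<in> borel_measurable borel"
  shows "indep_vars (\<lambda>_. borel) (\<lambda>j \<omega>. h (\<Sum>i<m. z i * A i j \<omega>) :: real) {..<n}"
proof -
  have "indep_vars (\<lambda>_. borel) (\<lambda>j \<omega>. (\<lambda>g. h (\<Sum>i<m. z i * g (i, j)))
      (\<lambda>p\<in>{..<m} \<times> {j}. (case p of (i, j) \<Rightarrow> A i j) \<omega>)) {..<n}"
    by (rule indep_vars_blocks[OF indep]) (auto simp: disjoint_family_on_def)
  then show ?thesis by simp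
qed

lemma row_form_std_normal:
  assumes "i < m" "L2_set x {..<n} = 1"
  shows "distributed M lborel (\<lambda>\<omega>. \<Sum>j<n. A i j \<omega> * x j) std_normal_density"
proof -
  have "distributed M lborel (\<lambda>\<omega>. \<Sum>j<n. x j * A i j \<omega>) std_normal_density"
    using assms by (intro std_normal_combination indep_row normal) (auto simp: L2_set_def)
  then show ?thesis by (simp add: mult.commute)
qed

lemma column_form_std_normal:
  assumes "j < n" "L2_set z {..<m} = 1"
  shows "distributed M lborel (\<lambda>\<omega>. \<Sum>i<m. z i * A i j \<omega>) std_normal_density"
  using assms by (intro std_normal_combination indep_column normal) (auto simp: L2_set_def)

lemma row_form_exp:
  assumes "i < m"
  shows "(\<integral>\<^sup>+\<omega>. ennreal (exp (\<Sum>j<n. A i j \<omega> * x j)) \<partial>M) \<le> ennreal (exp ((L2_set x {..<n})\<^sup>2 / 2))"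
proof (cases "L2_set x {..<n} = 0")
  \<comment> \<open>The zero vector cannot be normalised; it may arise as \<open>x + v\<close> for
    opposite net points.\<close>
  case True
  then have "(\<Sum>j<n. A i j \<omega> * x j) = 0" for \<omega>
    by (intro sum.neutral) (auto simp: L2_set_eq_0_iff)
  then show ?thesis
    using True by (simp add: emeasure_space_1)
next
  case False
  let ?r = "L2_set x {..<n}"
  have "L2_set (\<lambda>j. x j / ?r) {..<n} = (1 / ?r) * ?r"
    by (subst L2_set_right_distrib) auto
  then have "L2_set (\<lambda>j. x j / ?r) {..<n} = 1"
    using False by simp
  from std_normal_exp_linear[OF row_form_std_normal[OF assms this], of ?r]
  show ?thesis
    using False by (simp add: sum_distrib_left mult.commute)
qed

end

section \<open>The circumradius of the polyhedron\<close>

text \<open>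
  The sum \<open>b\<close> of the rows \<open>a\<^sub>i\<close> with \<open>\<langle>a\<^sub>i, x\<rangle> \<ge> t\<close>, for a net point \<open>x\<close>, has norm at most \<open>6 t\<close> times
  their number, since it suffices to test it against the net. So passing from \<open>x\<close> to a nearby unit
  vector \<open>u\<close> costs little, and one of these rows has a large inner product with \<open>u\<close>.
\<close>

lemma exists_large_row:
  fixes a :: "nat \<Rightarrow> nat \<Rightarrow> real"
  assumes t: "0 < t" and \<epsilon>: "0 < \<epsilon>" "\<epsilon> \<le> 1/2"
    and net: "\<And>u. L2_set u {..<n} = 1 \<Longrightarrow> \<exists>x\<in>T. L2_set (\<lambda>i. u i - x i) {..<n} \<le> \<epsilon>"
    and neg: "\<And>x v. x \<in> T \<Longrightarrow> v \<in> T \<Longrightarrow>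
      (\<Sum>i<m. if t \<le> (\<Sum>j<n. a i j * x j) then t * ((\<Sum>j<n. a i j * v j) - 3 * t) else 0) < 0"
    and u: "L2_set u {..<n} = 1"
  shows "\<exists>i<m. (1 - 6 * \<epsilon>) * t \<le> (\<Sum>j<n. a i j * u j)"
proof -
  obtain x where x: "x \<in> T" "L2_set (\<lambda>i. u i - x i) {..<n} \<le> \<epsilon>"
    using net[OF u] by blast
  define S where "S = {i. i < m \<and> t \<le> (\<Sum>j<n. a i j * x j)}"
  have finS: "finite S" by (simp add: S_def)
  define b where "b j = (\<Sum>i\<in>S. a i j)" for j
  have b_inner: "(\<Sum>j<n. b j * w j) = (\<Sum>i\<in>S. \<Sum>j<n. a i j * w j)" for w
    unfolding b_def sum_distrib_right by (rule sum.swap)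
  have restrict_sum: "(\<Sum>i<m. if t \<le> (\<Sum>j<n. a i j * x j) then g i else 0) = (\<Sum>i\<in>S. g i)" for g :: "nat \<Rightarrow> real"
  proof -
    have "(\<Sum>i<m. if t \<le> (\<Sum>j<n. a i j * x j) then g i else 0) =
        sum g ({..<m} \<inter> {i. t \<le> (\<Sum>j<n. a i j * x j)})"
      by (subst sum.inter_restrict) auto
    also have "{..<m} \<inter> {i. t \<le> (\<Sum>j<n. a i j * x j)} = S"
      by (auto simp: S_def)
    finally show ?thesis .
  qed
  have bv: "(\<Sum>j<n. b j * v j) < 3 * t * card S" if "v \<in> T" for v
  proof -
    have "(\<Sum>i\<in>S. t * ((\<Sum>j<n. a i j * v j) - 3 * t)) < 0"
      using neg[OF x(1) that] by (simp only: restrict_sum)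
    also have "(\<Sum>i\<in>S. t * ((\<Sum>j<n. a i j * v j) - 3 * t)) = t * ((\<Sum>j<n. b j * v j) - 3 * t * card S)"
      by (simp add: b_inner sum_subtractf algebra_simps flip: sum_distrib_left)
    finally show ?thesis
      using t by (simp add: mult_less_0_iff)
  qed
  \<comment> \<open>For empty \<open>S\<close> the bound \<open>bv\<close> would read 0 < 0.\<close>
  have "card S \<noteq> 0"
    using bv[OF x(1)] finS by (auto simp: b_def)
  then have cS: "0 < real (card S)" by simp
  have bx: "t * card S \<le> (\<Sum>j<n. b j * x j)"
  proof -
    have "t * card S = (\<Sum>i\<in>S. t)" by simp
    also have "\<dots> \<le> (\<Sum>i\<in>S. \<Sum>j<n. a i j * x j)"
      by (intro sum_mono) (simp add: S_def)
    finally show ?thesis by (simp add: b_inner)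
  qed
  have b_le: "L2_set b {..<n} \<le> 6 * t * card S"
  proof (cases "L2_set b {..<n} = 0")
    case True
    then show ?thesis using t by simp
  next
    case False
    let ?r = "L2_set b {..<n}"
    have r: "?r > 0"
      using False L2_set_nonneg[of b "{..<n}"] by linarith
    \<comment> \<open>Testing \<open>b\<close> against the net point nearest to its own direction
      loses at most half of its norm, which doubles the constant 3 to 6.\<close>
    obtain v where v: "v \<in> T" "L2_set (\<lambda>i. b i / ?r - v i) {..<n} \<le> \<epsilon>"
      using net[OF L2_set_normalize[OF False]] by blast
    have "(\<Sum>j<n. b j * b j) = ?r * ?r"
      using L2_set_power2[of b "{..<n}"] by (simp add: power2_eq_square)
    then have "?r = (\<Sum>j<n. b j * (b j / ?r))"
      using False by (simp flip: sum_divide_distrib)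
    also have "\<dots> = (\<Sum>j<n. b j * v j) + (\<Sum>j<n. b j * (b j / ?r - v j))"
      by (simp add: algebra_simps flip: sum.distrib)
    also have "(\<Sum>j<n. b j * (b j / ?r - v j)) \<le> ?r * L2_set (\<lambda>i. b i / ?r - v i) {..<n}"
      by (rule sum_mult_le_L2_set)
    also have "\<dots> \<le> ?r * (1/2)"
      using v \<epsilon> r by (intro mult_left_mono) auto
    finally show ?thesis
      using bv[OF v(1)] by simp
  qed
  \<comment> \<open>Replacing \<open>x\<close> by \<open>u\<close> costs at most
    \<open>\<epsilon>\<close> times the norm of \<open>b\<close>, so the average over
    \<open>S\<close> stays large, and some row reaches the average.\<close>
  have "(1 - 6 * \<epsilon>) * t * card S \<le> t * card S - L2_set b {..<n} * \<epsilon>"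
    using mult_right_mono[OF b_le, of \<epsilon>] \<epsilon> by (simp add: algebra_simps)
  also have "\<dots> \<le> t * card S - L2_set b {..<n} * L2_set (\<lambda>i. u i - x i) {..<n}"
    using x by (intro diff_left_mono mult_left_mono) auto
  also have "\<dots> \<le> (\<Sum>j<n. b j * x j) + (\<Sum>j<n. b j * (u j - x j))"
    using bx sum_mult_ge_L2_set[of b "{..<n}" "\<lambda>i. u i - x i"] by linarith
  also have "\<dots> = (\<Sum>j<n. b j * u j)"
    by (simp add: algebra_simps flip: sum.distrib)
  also have "\<dots> = (\<Sum>i\<in>S. \<Sum>j<n. a i j * u j)"
    by (rule b_inner)
  finally have ge: "(\<Sum>i\<in>S. (1 - 6 * \<epsilon>) * t) \<le> (\<Sum>i\<in>S. \<Sum>j<n. a i j * u j)"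
    by (simp add: mult.commute)
  show ?thesis
  proof (rule ccontr)
    assume "\<not> ?thesis"
    then have "(\<Sum>i\<in>S. \<Sum>j<n. a i j * u j) < (\<Sum>i\<in>S. (1 - 6 * \<epsilon>) * t)"
      using finS \<open>card S \<noteq> 0\<close> by (intro sum_strict_mono) (auto simp: S_def not_le)
    with ge show False by simp
  qed
qed

text \<open>In the direction of \<open>x\<close> some row has pairing at least \<open>r\<close>
  times the norm of \<open>x\<close>, and this pairing is at most 1 on the polyhedron.\<close>

lemma polyhedron_subset_ball:
  fixes a :: "nat \<Rightarrow> nat \<Rightarrow> real"
  assumes r: "0 < r" and row: "\<And>u. L2_set u {..<n} = 1 \<Longrightarrow> \<exists>i<m. r \<le> (\<Sum>j<n. a i j * u j)"
    and x: "x \<in> polyhedron_of m n a"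
  shows "L2_set x {..<n} \<le> 1 / r"
proof (cases "L2_set x {..<n} = 0")
  case True
  then show ?thesis using r by simp
next
  case False
  let ?l = "L2_set x {..<n}"
  have l: "?l > 0"
    using False L2_set_nonneg[of x "{..<n}"] by linarith
  obtain i where i: "i < m" "r \<le> (\<Sum>j<n. a i j * (x j / ?l))"
    using row[OF L2_set_normalize[OF False]] by blast
  have "(\<Sum>j<n. a i j * (x j / ?l)) = (\<Sum>j<n. a i j * x j) / ?l"
    by (simp add: sum_divide_distrib)
  also have "\<dots> \<le> 1 / ?l"
    using x i l by (intro divide_right_mono) (auto simp: polyhedron_of_def)
  finally have "r \<le> 1 / ?l"
    using i by linarith
  then show ?thesis
    using l r by (simp add: field_simps)
qed

context gaussian_matrix
begin

text \<open>
  The constant 3 makes the contribution of the rows with \<open>\<langle>a\<^sub>i, x\<rangle> \<ge> t\<close>, bounded by means of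
  \<open>1\<^bsub>s \<ge> t\<^esub> \<le> exp (t (s - t))\<close>, smaller than half of their probability.
\<close>

lemma row_excess_exp:
  assumes i: "i < m" and x: "L2_set x {..<n} = 1" and v: "L2_set v {..<n} = 1" and t: "3 \<le> t"
  shows "(\<integral>\<^sup>+\<omega>. ennreal (exp (if t \<le> (\<Sum>j<n. A i j \<omega> * x j)
            then t * ((\<Sum>j<n. A i j \<omega> * v j) - 3 * t) else 0)) \<partial>M) \<le>
         ennreal (1 - exp (- (t + 1)\<^sup>2 / 2) / 6)" (is "(\<integral>\<^sup>+\<omega>. ennreal (exp (?Z \<omega>)) \<partial>M) \<le> _")
proof -
  let ?X = "\<lambda>\<omega>. \<Sum>j<n. A i j \<omega> * x j" and ?V = "\<lambda>\<omega>. \<Sum>j<n. A i j \<omega> * v j"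
  let ?q = "exp (- (t + 1)\<^sup>2 / 2)" and ?w = "\<lambda>j. t * (x j + v j)"
  note [measurable] = measurable_row_form[OF i]
  let ?S = "{\<omega>\<in>space M. t \<le> ?X \<omega>}"
  have S: "?S \<in> events" by measurable
  have w: "(\<Sum>j<n. A i j \<omega> * ?w j) = t * (?X \<omega> + ?V \<omega>)" for \<omega>
    by (simp add: sum_distrib_left algebra_simps flip: sum.distrib)
  have "L2_set ?w {..<n} \<le> t * 2"
  proof -
    have "L2_set (\<lambda>j. x j + v j) {..<n} \<le> 2"
      using L2_set_triangle_ineq[of x v "{..<n}"] x v by simp
    then show ?thesis
      using t by (simp add: L2_set_scale)
  qed
  then have w_norm: "(L2_set ?w {..<n})\<^sup>2 \<le> (t * 2)\<^sup>2"
    by (intro power_mono) auto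
  \<comment> \<open>Off \<open>?S\<close> the exponential is 1; on \<open>?S\<close> it is dominated
    by the exponential of one linear form, with direction \<open>?w\<close> of norm at most
    \<open>2 * t\<close>.\<close>
  have "(\<integral>\<^sup>+\<omega>. ennreal (exp (?Z \<omega>)) \<partial>M) \<le>
      (\<integral>\<^sup>+\<omega>. indicator (space M - ?S) \<omega> + ennreal (exp (- 4 * t\<^sup>2)) * ennreal (exp (\<Sum>j<n. A i j \<omega> * ?w j)) \<partial>M)"
  proof (rule nn_integral_mono)
    fix \<omega> assume \<omega>: "\<omega> \<in> space M"
    show "ennreal (exp (?Z \<omega>)) \<le>
      indicator (space M - ?S) \<omega> + ennreal (exp (- 4 * t\<^sup>2)) * ennreal (exp (\<Sum>j<n. A i j \<omega> * ?w j))"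
    proof (cases "t \<le> ?X \<omega>")
      case True
      have "t * t \<le> t * ?X \<omega>"
        using True t by (intro mult_left_mono) auto
      then have "t * (?V \<omega> - 3 * t) \<le> - 4 * t\<^sup>2 + t * (?X \<omega> + ?V \<omega>)"
        by (simp add: power2_eq_square algebra_simps)
      then show ?thesis
        using True \<omega> by (simp add: w flip: ennreal_mult exp_add)
    next
      case False
      then show ?thesis using \<omega> by (simp add: add_increasing2)
    qed
  qed
  also have "\<dots> = emeasure M (space M - ?S) +
      ennreal (exp (- 4 * t\<^sup>2)) * (\<integral>\<^sup>+\<omega>. ennreal (exp (\<Sum>j<n. A i j \<omega> * ?w j)) \<partial>M)"
  proof -
    let ?f = "\<lambda>\<omega>. ennreal (exp (\<Sum>j<n. A i j \<omega> * ?w j))"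
    have f: "?f \<in> borel_measurable M"
      using measurable_row_form[OF i, of ?w] by measurable
    have "(\<integral>\<^sup>+\<omega>. indicator (space M - ?S) \<omega> + ennreal (exp (- 4 * t\<^sup>2)) * ?f \<omega> \<partial>M) =
        (\<integral>\<^sup>+\<omega>. indicator (space M - ?S) \<omega> \<partial>M) + (\<integral>\<^sup>+\<omega>. ennreal (exp (- 4 * t\<^sup>2)) * ?f \<omega> \<partial>M)"
      by (intro nn_integral_add borel_measurable_indicator borel_measurable_times_ennreal
          borel_measurable_const f sets.compl_sets S)
    also have "(\<integral>\<^sup>+\<omega>. ennreal (exp (- 4 * t\<^sup>2)) * ?f \<omega> \<partial>M) = ennreal (exp (- 4 * t\<^sup>2)) * (\<integral>\<^sup>+\<omega>. ?f \<omega> \<partial>M)"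
      by (rule nn_integral_cmult[OF f])
    also have "(\<integral>\<^sup>+\<omega>. indicator (space M - ?S) \<omega> \<partial>M) = emeasure M (space M - ?S)"
      by (rule nn_integral_indicator) (intro sets.compl_sets S)
    finally show ?thesis .
  qed
  also have "\<dots> \<le> ennreal (1 - ?q / 3) + ennreal (exp (- 4 * t\<^sup>2)) * ennreal (exp ((t * 2)\<^sup>2 / 2))"
  proof (intro add_mono mult_left_mono)
    have "prob (space M - ?S) \<le> 1 - ?q / 3"
      using std_normal_lower_tail[OF row_form_std_normal[OF i x], of t] t S by (simp add: prob_compl)
    then show "emeasure M (space M - ?S) \<le> ennreal (1 - ?q / 3)"
      using S by (simp add: emeasure_eq_measure ennreal_leI)
    show "(\<integral>\<^sup>+\<omega>. ennreal (exp (\<Sum>j<n. A i j \<omega> * ?w j)) \<partial>M) \<le> ennreal (exp ((t * 2)\<^sup>2 / 2))"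
      by (rule order.trans[OF row_form_exp[OF i]]) (use w_norm in \<open>auto intro!: ennreal_leI\<close>)
  qed auto
  also have "\<dots> = ennreal (1 - ?q / 3 + exp (- 2 * t\<^sup>2))"
  proof -
    have "exp (- 4 * t\<^sup>2) * exp ((t * 2)\<^sup>2 / 2) = exp (- 2 * t\<^sup>2)"
      by (simp add: power_mult_distrib flip: exp_add)
    then have prod: "ennreal (exp (- 4 * t\<^sup>2)) * ennreal (exp ((t * 2)\<^sup>2 / 2)) = ennreal (exp (- 2 * t\<^sup>2))"
      by (subst ennreal_mult[symmetric]) auto
    have "?q \<le> exp 0"
      unfolding exp_le_cancel_iff by simp
    then have "0 \<le> 1 - ?q / 3"
      unfolding exp_zero by linarith
    then show ?thesis
      unfolding prod by (rule ennreal_plus[symmetric]) simp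
  qed
  also have "\<dots> \<le> ennreal (1 - ?q / 6)"
  proof (rule ennreal_leI)
    \<comment> \<open>Here \<open>3 \<le> t\<close> enters: the tilted term is at most
      \<open>?q / 6\<close>, half of the mass \<open>?q / 3\<close> gained on
      \<open>?S\<close>.\<close>
    have "6 + (t + 1)\<^sup>2 / 2 \<le> 2 * t\<^sup>2"
    proof -
      have "0 \<le> (t - 3) * (3 * t + 7)" using t by simp
      then show ?thesis using t by (simp add: power2_eq_square field_simps)
    qed
    then have "exp (- 2 * t\<^sup>2) \<le> exp (- 6) * ?q"
      by (simp flip: exp_add)
    also have "\<dots> \<le> 1 / 6 * ?q"
      using exp_ge_add_one_self[of 6] by (intro mult_right_mono) (auto simp: exp_minus field_simps)
    finally show "1 - ?q / 3 + exp (- 2 * t\<^sup>2) \<le> 1 - ?q / 6" by simp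
  qed
  finally show ?thesis .
qed

lemma prob_row_excess:
  assumes x: "L2_set x {..<n} = 1" and v: "L2_set v {..<n} = 1" and t: "3 \<le> t"
  shows "prob {\<omega>\<in>space M. 0 \<le> (\<Sum>i<m. if t \<le> (\<Sum>j<n. A i j \<omega> * x j)
            then t * ((\<Sum>j<n. A i j \<omega> * v j) - 3 * t) else 0)} \<le>
         exp (- real m * exp (- (t + 1)\<^sup>2 / 2) / 6)"
proof -
  let ?q = "exp (- (t + 1)\<^sup>2 / 2)"
  have "?q \<le> exp 0"
    unfolding exp_le_cancel_iff by simp
  then have q: "0 \<le> 1 - ?q / 6"
    unfolding exp_zero by linarith
  have "prob {\<omega>\<in>space M. 0 \<le> (\<Sum>i<m. if t \<le> (\<Sum>j<n. A i j \<omega> * x j)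
            then t * ((\<Sum>j<n. A i j \<omega> * v j) - 3 * t) else 0)} \<le> exp (- 0) * (1 - ?q / 6) ^ card {..<m}"
    by (intro chernoff_sum row_excess_exp indep_row_forms[where h = "\<lambda>s r. if t \<le> s then t * (r - 3 * t) else 0"]
         x v t) (use q in auto)
  also have "\<dots> = (1 - ?q / 6) ^ m" by simp
  also have "\<dots> \<le> exp (- ?q / 6) ^ m"
    using exp_ge_add_one_self[of "- ?q / 6"] q by (intro power_mono) auto
  also have "\<dots> = exp (- real m * ?q / 6)"
    by (simp flip: exp_of_nat_mult)
  finally show ?thesis .
qed

end

text \<open>A union bound over pairs of net points. The threshold depends on \<open>\<delta>\<close>
  only, so it serves all sizes at once.\<close>

lemma (in prob_space) polyhedron_subset_ball_whp:
  fixes \<delta> :: real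
  assumes \<delta>: "0 < \<delta>" "\<delta> \<le> 1"
  obtains L\<^sub>0 :: real where "\<And>m n A. gaussian_matrix M m n A \<Longrightarrow> 1 \<le> n \<Longrightarrow> L\<^sub>0 \<le> ln (real m / real n) \<Longrightarrow>
    \<exists>B\<in>events. prob B \<le> exp (- real n) \<and>
      (\<forall>\<omega>\<in>space M - B. \<forall>x\<in>polyhedron_of m n (\<lambda>i j. A i j \<omega>).
         L2_set x {..<n} \<le> (1 + \<delta>) / sqrt (2 * ln (real m / real n)))"
proof -
  \<comment> \<open>The radius loses \<open>6 * \<epsilon>\<close> from the net and
    \<open>\<epsilon>\<close> from the level \<open>t\<close>; with 24 the product
    \<open>(1 + \<delta>) * (1 - 7 * \<epsilon>)\<close> is at least 1 for
    \<open>\<delta> \<le> 1\<close>.\<close>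
  define \<epsilon> where "\<epsilon> = \<delta> / 24"
  have \<epsilon>: "0 < \<epsilon>" "\<epsilon> \<le> 1/24"
    using \<delta> by (auto simp: \<epsilon>_def)
  obtain K :: real where K: "K \<ge> 1" and net: "\<And>n. n \<ge> 1 \<Longrightarrow>
      \<exists>T. finite T \<and> real (card T) \<le> K ^ n \<and> (\<forall>x\<in>T. L2_set x {..<n} = 1) \<and>
        (\<forall>u. L2_set u {..<n} = 1 \<longrightarrow> (\<exists>x\<in>T. L2_set (\<lambda>i. u i - x i) {..<n} \<le> \<epsilon>))"
    by (rule sphere_net[of \<epsilon>]) (use \<epsilon> in simp_all)
  \<comment> \<open>The three entries give \<open>6 \<le> s\<close> and hence
    \<open>3 \<le> t\<close>, then \<open>t + 1 \<le> (1 - \<epsilon> / 2) * s\<close>, and finally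
    an exponent that pays for the square of the cardinality of the net.\<close>
  define L\<^sub>0 where "L\<^sub>0 = max (max 18 (2 / \<epsilon>\<^sup>2)) (12 * (2 * ln K + 1) / \<epsilon>)"
  show ?thesis
  proof (rule that)
    fix m n :: nat and A :: "nat \<Rightarrow> nat \<Rightarrow> 'a \<Rightarrow> real"
    assume "gaussian_matrix M m n A" and n: "1 \<le> n" and L\<^sub>0: "L\<^sub>0 \<le> ln (real m / real n)"
    interpret gaussian_matrix M m n A by fact
    define L where "L = ln (real m / real n)"
    have L: "18 \<le> L" "2 / \<epsilon>\<^sup>2 \<le> L" "12 * (2 * ln K + 1) / \<epsilon> \<le> L"
      using L\<^sub>0 by (auto simp: L\<^sub>0_def L_def)
    \<comment> \<open>For \<open>m = 0\<close> the logarithm takes its default value 0, below the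
      threshold.\<close>
    have "m \<noteq> 0"
      using L(1) by (cases "m = 0") (auto simp: L_def)
    then have m: "real m = real n * exp L"
      using n by (simp add: L_def)
    define s where "s = sqrt (2 * L)"
    have s2: "s\<^sup>2 = 2 * L" and s6: "6 \<le> s" and s_eps: "1 \<le> \<epsilon> / 2 * s"
    proof -
      show "s\<^sup>2 = 2 * L" using L by (simp add: s_def)
      show "6 \<le> s" using L by (auto simp: s_def intro!: real_le_rsqrt)
      have "2 / \<epsilon> \<le> s"
        unfolding s_def using L \<epsilon> by (intro real_le_rsqrt) (simp add: power_divide)
      then show "1 \<le> \<epsilon> / 2 * s"
        using \<epsilon> by (simp add: field_simps)
    qed
    define t where "t = (1 - \<epsilon>) * s"
    have "1 / 2 * 6 \<le> (1 - \<epsilon>) * s"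
      using s6 \<epsilon> by (intro mult_mono) auto
    then have t3: "3 \<le> t" by (simp add: t_def)
    obtain T where T: "finite T" "real (card T) \<le> K ^ n" "\<And>x. x \<in> T \<Longrightarrow> L2_set x {..<n} = 1"
      and T_net: "\<And>u. L2_set u {..<n} = 1 \<Longrightarrow> \<exists>x\<in>T. L2_set (\<lambda>i. u i - x i) {..<n} \<le> \<epsilon>"
      using net[OF n] by blast
    define Z where "Z x v \<omega> = (\<Sum>i<m. if t \<le> (\<Sum>j<n. A i j \<omega> * x j)
            then t * ((\<Sum>j<n. A i j \<omega> * v j) - 3 * t) else 0)" for x v \<omega>
    define E where "E p = {\<omega>\<in>space M. 0 \<le> Z (fst p) (snd p) \<omega>}" for p
    have meas: "E p \<in> events" for p
    proof -
      have "Z (fst p) (snd p) \<in> borel_measurable M"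
        unfolding Z_def by (intro borel_measurable_sum measurable_If borel_measurable_times
          borel_measurable_diff borel_measurable_const borel_measurable_le measurable_row_form)
          (auto intro!: borel_measurable_le measurable_row_form)
      then show ?thesis unfolding E_def by measurable
    qed
    define B where "B = (\<Union>p\<in>T \<times> T. E p)"
    \<comment> \<open>Since \<open>(t + 1)\<^sup>2 / 2\<close> is at most
      \<open>(1 - \<epsilon> / 2) * L\<close>, the quantity
      \<open>real m * exp (- (t + 1)\<^sup>2 / 2)\<close> is at least
      \<open>real n * exp (\<epsilon> * L / 2)\<close>, a large multiple of
      \<open>n\<close>.\<close>
    have exponent: "real n * (2 * ln K + 1) \<le> real m * exp (- (t + 1)\<^sup>2 / 2) / 6"
    proof -
      have "t + 1 \<le> (1 - \<epsilon> / 2) * s"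
        using s_eps by (simp add: t_def algebra_simps)
      then have "(t + 1)\<^sup>2 \<le> ((1 - \<epsilon> / 2) * s)\<^sup>2"
        using t3 by (intro power_mono) auto
      also have "\<dots> = (1 - \<epsilon> / 2) * ((1 - \<epsilon> / 2) * (2 * L))"
        by (simp add: power_mult_distrib s2) (simp add: power2_eq_square)
      also have "\<dots> \<le> 1 * ((1 - \<epsilon> / 2) * (2 * L))"
        using \<epsilon> L by (intro mult_right_mono) auto
      finally have "\<epsilon> * L / 2 \<le> L + - (t + 1)\<^sup>2 / 2"
        by (simp add: field_simps)
      then have "exp (\<epsilon> * L / 2) \<le> exp L * exp (- (t + 1)\<^sup>2 / 2)"
        by (simp flip: exp_add)
      moreover have "6 * (2 * ln K + 1) \<le> \<epsilon> * L / 2"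
        using L(3) \<epsilon> by (simp add: field_simps)
      moreover have "\<epsilon> * L / 2 \<le> exp (\<epsilon> * L / 2)"
        using exp_ge_add_one_self[of "\<epsilon> * L / 2"] by linarith
      ultimately have "6 * (2 * ln K + 1) \<le> exp L * exp (- (t + 1)\<^sup>2 / 2)"
        by (meson order.trans)
      then have "2 * ln K + 1 \<le> exp L * exp (- (t + 1)\<^sup>2 / 2) / 6"
        by (simp only: pos_le_divide_eq zero_less_numeral mult.commute)
      then have "real n * (2 * ln K + 1) \<le> real n * (exp L * exp (- (t + 1)\<^sup>2 / 2) / 6)"
        by (rule mult_left_mono) simp
      then show ?thesis by (simp add: m)
    qed
    have "prob B \<le> (\<Sum>p\<in>T \<times> T. prob (E p))"
      unfolding B_def using T meas by (intro finite_measure_subadditive_finite) auto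
    also have "\<dots> \<le> (\<Sum>p\<in>T \<times> T. exp (- real n * (2 * ln K + 1)))"
    proof (rule sum_mono)
      fix p assume "p \<in> T \<times> T"
      then have "prob (E p) \<le> exp (- real m * exp (- (t + 1)\<^sup>2 / 2) / 6)"
        unfolding E_def Z_def using T t3 by (intro prob_row_excess) auto
      also have "\<dots> \<le> exp (- real n * (2 * ln K + 1))"
        using exponent by simp
      finally show "prob (E p) \<le> exp (- real n * (2 * ln K + 1))" .
    qed
    also have "\<dots> = (real (card T))\<^sup>2 * exp (- real n * (2 * ln K + 1))"
      by (simp add: power2_eq_square card_cartesian_product)
    also have "\<dots> \<le> (K ^ n)\<^sup>2 * exp (- real n * (2 * ln K + 1))"
      using T by (intro mult_right_mono power_mono) auto
    also have "K ^ n = exp (real n * ln K)"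
      using K by (simp add: exp_of_nat_mult)
    also have "(exp (real n * ln K))\<^sup>2 * exp (- real n * (2 * ln K + 1)) = exp (- real n)"
      by (simp add: algebra_simps flip: exp_add exp_double)
    finally have "prob B \<le> exp (- real n)" .
    moreover have "L2_set x {..<n} \<le> (1 + \<delta>) / sqrt (2 * ln (real m / real n))"
      if \<omega>: "\<omega> \<in> space M - B" and x: "x \<in> polyhedron_of m n (\<lambda>i j. A i j \<omega>)" for \<omega> x
    proof -
      have "L2_set x {..<n} \<le> 1 / ((1 - 6 * \<epsilon>) * t)"
      proof (rule polyhedron_subset_ball[OF _ _ x])
        show "0 < (1 - 6 * \<epsilon>) * t" using \<epsilon> t3 by simp
        fix u assume "L2_set u {..<n} = 1"
        then show "\<exists>i<m. (1 - 6 * \<epsilon>) * t \<le> (\<Sum>j<n. A i j \<omega> * u j)"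
        proof (rule exists_large_row[rotated -1])
          show "0 < t" "0 < \<epsilon>" "\<epsilon> \<le> 1 / 2" using t3 \<epsilon> by auto
        next
          fix x v assume "x \<in> T" "v \<in> T"
          then have "\<omega> \<notin> E (x, v)"
            using \<omega> by (auto simp: B_def)
          then show "(\<Sum>i<m. if t \<le> (\<Sum>j<n. A i j \<omega> * x j)
            then t * ((\<Sum>j<n. A i j \<omega> * v j) - 3 * t) else 0) < 0"
            using \<omega> unfolding E_def Z_def fst_conv snd_conv by auto
        qed (rule T_net)
      qed
      also have "\<dots> = 1 / ((1 - 6 * \<epsilon>) * (1 - \<epsilon>)) / s"
        by (simp add: t_def)
      also have "\<dots> \<le> (1 + \<delta>) / s"
      proof (rule divide_right_mono)
        have "1 \<le> (1 + \<delta>) * ((1 - 6 * \<epsilon>) * (1 - \<epsilon>))"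
        proof -
          have "(1 + \<delta>) * (1 - 7 * \<epsilon>) \<le> (1 + \<delta>) * ((1 - 6 * \<epsilon>) * (1 - \<epsilon>))"
            using \<delta> \<epsilon> by (intro mult_left_mono) (auto simp: algebra_simps)
          moreover have "\<delta> * \<delta> \<le> \<delta>" using \<delta> mult_left_mono[of \<delta> 1 \<delta>] by simp
          then have "1 \<le> (1 + \<delta>) * (1 - 7 * \<epsilon>)"
            using \<delta> by (simp add: \<epsilon>_def algebra_simps)
          ultimately show ?thesis by linarith
        qed
        then show "1 / ((1 - 6 * \<epsilon>) * (1 - \<epsilon>)) \<le> 1 + \<delta>"
          using \<epsilon> by (simp add: divide_le_eq)
      qed (use s6 in simp)
      finally show ?thesis by (simp add: s_def L_def)
    qed
    moreover have "B \<in> events"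
      unfolding B_def using T meas by auto
    ultimately show "\<exists>B\<in>events. prob B \<le> exp (- real n) \<and>
      (\<forall>\<omega>\<in>space M - B. \<forall>x\<in>polyhedron_of m n (\<lambda>i j. A i j \<omega>).
         L2_set x {..<n} \<le> (1 + \<delta>) / sqrt (2 * ln (real m / real n)))"
      by blast
  qed
qed

section \<open>The support function in a typical direction\<close>

text \<open>The square of \<open>N\<close> in the overview. It vanishes exactly when no row exceeds
  the level \<open>\<tau>\<close> in direction \<open>c\<close>.\<close>

definition excess :: "nat \<Rightarrow> nat \<Rightarrow> real \<Rightarrow> (nat \<Rightarrow> nat \<Rightarrow> real) \<Rightarrow> (nat \<Rightarrow> real) \<Rightarrow> real" where
  "excess m n \<tau> a c = (\<Sum>i<m. (max 0 ((\<Sum>j<n. a i j * c j) - \<tau>))\<^sup>2)"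

lemma excess_nonneg: "0 \<le> excess m n \<tau> a c"
  by (simp add: excess_def sum_nonneg)

lemma combination_le_excess:
  fixes a :: "nat \<Rightarrow> nat \<Rightarrow> real"
  assumes y: "\<And>i. i < m \<Longrightarrow> 0 \<le> y i" "(\<Sum>i<m. y i) = 1"
    and c: "L2_set c {..<n} = 1" and eq: "\<And>j. j < n \<Longrightarrow> (\<Sum>i<m. y i * a i j) = \<mu> * c j"
  shows "\<mu> \<le> \<tau> + L2_set y {..<m} * sqrt (excess m n \<tau> a c)"
proof -
  let ?g = "\<lambda>i. \<Sum>j<n. a i j * c j"
  have "\<mu> = (\<Sum>j<n. \<mu> * c j * c j)"
    using c L2_set_power2[of c "{..<n}"] by (simp add: power2_eq_square mult.assoc flip: sum_distrib_left)
  also have "\<dots> = (\<Sum>j<n. (\<Sum>i<m. y i * a i j) * c j)"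
    by (intro sum.cong) (auto simp: eq)
  also have "\<dots> = (\<Sum>i<m. y i * ?g i)"
    unfolding sum_distrib_left sum_distrib_right by (subst sum.swap) (simp add: mult.assoc)
  also have "\<dots> \<le> (\<Sum>i<m. y i * \<tau> + y i * max 0 (?g i - \<tau>))"
    using y by (intro sum_mono) (auto simp flip: distrib_left intro!: mult_left_mono)
  also have "\<dots> = \<tau> + (\<Sum>i<m. y i * max 0 (?g i - \<tau>))"
    using y by (simp add: sum.distrib flip: sum_distrib_right)
  also have "(\<Sum>i<m. y i * max 0 (?g i - \<tau>)) \<le> L2_set y {..<m} * sqrt (excess m n \<tau> a c)"
    using sum_mult_le_L2_set[of y "\<lambda>i. max 0 (?g i - \<tau>)" "{..<m}"] by (simp add: L2_set_def excess_def)
  finally show ?thesis by simp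
qed

text \<open>
  Maurey's lemma is applied to the rows of \<open>a\<close> extended by \<open>\<surd>n\<close> times the identity matrix, so
  that a single sparse vector approximates \<open>y\<close> and its image simultaneously.
\<close>

lemma L2_set_le_of_sparse_isometry:
  fixes a :: "nat \<Rightarrow> nat \<Rightarrow> real"
  assumes n: "1 \<le> n" and k: "1 \<le> k"
    and rows: "\<And>i. i < m \<Longrightarrow> (\<Sum>j<n. (a i j)\<^sup>2) \<le> 16 * real n"
    and sparse: "\<And>z :: nat \<Rightarrow> nat. (\<Sum>i<m. z i) = k \<Longrightarrow>
        real n * (\<Sum>i<m. (real (z i))\<^sup>2) \<le> 36 * (\<Sum>j<n. (\<Sum>i<m. real (z i) * a i j)\<^sup>2)"
    and y: "\<And>i. i < m \<Longrightarrow> 0 \<le> y i" "(\<Sum>i<m. y i) = 1"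
  shows "sqrt (real n) * L2_set y {..<m} \<le>
    6 * L2_set (\<lambda>j. \<Sum>i<m. y i * a i j) {..<n} + 7 * sqrt (17 * real n / real k)"
proof -
  define q where "q j = (\<Sum>i<m. y i * a i j)" for j
  define b :: "nat \<Rightarrow> nat + nat \<Rightarrow> real"
    where "b i = case_sum (a i) (\<lambda>l. if l = i then sqrt (real n) else 0)" for i
  define J :: "(nat + nat) set" where "J = {..<n} <+> {..<m}"
  have sum_J: "(\<Sum>j\<in>J. g j) = (\<Sum>j<n. g (Inl j)) + (\<Sum>l<m. g (Inr l))" for g :: "nat + nat \<Rightarrow> real"
    by (simp add: J_def sum.Plus)
  have diag: "(\<Sum>i<m. g i * b i (Inr l)) = g l * sqrt (real n)" if "l < m" for g :: "nat \<Rightarrow> real" and l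
  proof -
    have "(\<Sum>i<m. g i * b i (Inr l)) = (\<Sum>i<m. if i = l then g i * sqrt (real n) else 0)"
      by (intro sum.cong) (auto simp: b_def)
    then show ?thesis using that by simp
  qed
  \<comment> \<open>A row contributes \<open>16 * real n\<close> and its diagonal entry one further
    \<open>real n\<close>.\<close>
  have "(\<Sum>j\<in>J. (b i j)\<^sup>2) \<le> 17 * real n" if "i < m" for i
  proof -
    have "(\<Sum>l<m. (b i (Inr l))\<^sup>2) = (\<Sum>l<m. if l = i then real n else 0)"
      by (intro sum.cong) (auto simp: b_def)
    then show ?thesis
      using rows[OF that] that by (simp add: sum_J) (simp add: b_def)
  qed
  then obtain z :: "nat \<Rightarrow> nat" where z: "(\<Sum>i<m. z i) = k" and
    err: "(\<Sum>j\<in>J. ((\<Sum>i<m. real (z i) * b i j) - real k * (\<Sum>i<m. y i * b i j))\<^sup>2) \<le> real k * (17 * real n)"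
    using maurey[of J m y b "17 * real n" k] y by (auto simp: J_def)
  define e where "e = sqrt (real k * (17 * real n))"
  have e2: "e\<^sup>2 = real k * (17 * real n)" and e: "0 \<le> e"
    by (auto simp: e_def)
  let ?Az = "\<lambda>j. \<Sum>i<m. real (z i) * a i j"
  have "(\<Sum>j<n. (?Az j - real k * q j)\<^sup>2) + (\<Sum>l<m. (real (z l) * sqrt (real n) - real k * (y l * sqrt (real n)))\<^sup>2) \<le> e\<^sup>2"
    using err unfolding sum_J e2 by (simp add: diag) (simp add: b_def q_def)
  moreover have "(\<Sum>l<m. (real (z l) * sqrt (real n) - real k * (y l * sqrt (real n)))\<^sup>2) =
      (sqrt (real n) * L2_set (\<lambda>l. real (z l) - real k * y l) {..<m})\<^sup>2"
    unfolding power_mult_distrib L2_set_power2 sum_distrib_left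
    by (intro sum.cong refl) (simp add: power2_eq_square algebra_simps)
  ultimately have "(L2_set (\<lambda>j. ?Az j - real k * q j) {..<n})\<^sup>2 +
      (sqrt (real n) * L2_set (\<lambda>l. real (z l) - real k * y l) {..<m})\<^sup>2 \<le> e\<^sup>2"
    by (simp add: L2_set_power2)
  then have "(L2_set (\<lambda>j. ?Az j - real k * q j) {..<n})\<^sup>2 \<le> e\<^sup>2"
    and "(sqrt (real n) * L2_set (\<lambda>l. real (z l) - real k * y l) {..<m})\<^sup>2 \<le> e\<^sup>2"
    by (smt (verit) zero_le_power2)+
  then have e1: "L2_set (\<lambda>j. ?Az j - real k * q j) {..<n} \<le> e"
    and e2: "sqrt (real n) * L2_set (\<lambda>l. real (z l) - real k * y l) {..<m} \<le> e"
    using e by (auto dest!: power2_le_imp_le)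
  \<comment> \<open>The error \<open>e\<close> enters once for \<open>y\<close> and, through the
    factor 6 of the sparse bound, six times for the image.\<close>
  have "sqrt (real n) * (real k * L2_set y {..<m}) = sqrt (real n) * L2_set (\<lambda>l. real k * y l) {..<m}"
    by (simp add: L2_set_scale)
  also have "\<dots> \<le> sqrt (real n) * (L2_set (\<lambda>l. real (z l)) {..<m} + L2_set (\<lambda>l. real (z l) - real k * y l) {..<m})"
    using L2_set_triangle_diff[of "\<lambda>l. real k * y l" "{..<m}" "\<lambda>l. real (z l)"]
      L2_set_diff_commute[of "\<lambda>l. real k * y l" "\<lambda>l. real (z l)" "{..<m}"]
    by (intro mult_left_mono) auto
  also have "\<dots> \<le> sqrt (real n) * L2_set (\<lambda>l. real (z l)) {..<m} + e"
    using e2 by (simp add: algebra_simps)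
  also have "sqrt (real n) * L2_set (\<lambda>l. real (z l)) {..<m} \<le> 6 * L2_set ?Az {..<n}"
  proof -
    have "sqrt (real n) * L2_set (\<lambda>l. real (z l)) {..<m} = sqrt (real n * (\<Sum>i<m. (real (z i))\<^sup>2))"
      by (simp add: L2_set_def real_sqrt_mult)
    also have "\<dots> \<le> sqrt (36 * (\<Sum>j<n. (?Az j)\<^sup>2))"
      using sparse[OF z] by simp
    also have "\<dots> = 6 * L2_set ?Az {..<n}"
      using real_sqrt_abs[of 6] by (simp add: L2_set_def real_sqrt_mult)
    finally show ?thesis .
  qed
  also have "L2_set ?Az {..<n} \<le> L2_set (\<lambda>j. real k * q j) {..<n} + e"
    using L2_set_triangle_diff[of ?Az "{..<n}" "\<lambda>j. real k * q j"] e1 by simp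
  also have "L2_set (\<lambda>j. real k * q j) {..<n} = real k * L2_set q {..<n}"
    by (simp add: L2_set_scale)
  finally have "real k * (sqrt (real n) * L2_set y {..<m}) \<le> real k * (6 * L2_set q {..<n}) + 7 * e"
    by (simp add: algebra_simps)
  also have "e = real k * sqrt (17 * real n / real k)"
  proof -
    have "real k * (17 * real n) = (real k)\<^sup>2 * (17 * real n / real k)"
      using k by (simp add: power2_eq_square)
    then show ?thesis
      unfolding e_def by (simp only: real_sqrt_mult) simp
  qed
  finally have "real k * (sqrt (real n) * L2_set y {..<m}) \<le>
      real k * (6 * L2_set q {..<n} + 7 * sqrt (17 * real n / real k))"
    by (simp add: algebra_simps)
  then show ?thesis
    using k by (simp add: q_def[abs_def])
qed

text \<open>Generating function bound at \<open>x = k / m\<close>: every composition weighs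
  \<open>x ^ k\<close>, while each coordinate sums to at most \<open>exp (2 * x)\<close>, which
  gives \<open>exp (2 * k)\<close> over all \<open>m\<close> coordinates.\<close>

lemma card_compositions_le:
  assumes k: "1 \<le> k" "2 * k \<le> m"
  shows "real (card {z \<in> {..<m} \<rightarrow>\<^sub>E {..k}. (\<Sum>i<m. z i) = k}) \<le> (real m / real k) ^ k * exp (2 * real k)"
proof -
  define x where "x = real k / real m"
  have x: "0 < x" "x \<le> 1/2" using k by (auto simp: x_def field_simps)
  have "real (card {z \<in> {..<m} \<rightarrow>\<^sub>E {..k}. (\<Sum>i<m. z i) = k}) * x ^ k \<le> (\<Sum>j\<in>{..k}. x ^ j) ^ card {..<m}"
    by (rule card_le_of_weight) (use x in \<open>auto simp flip: power_sum\<close>)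
  also have "(\<Sum>j\<in>{..k}. x ^ j) \<le> exp (2 * x)"
  proof -
    have "(1 - x) * (\<Sum>j\<le>k. x ^ j) = 1 - x ^ Suc k"
      by (rule sum_gp_basic)
    also have "\<dots> \<le> 1" using x by simp
    also have "1 \<le> (1 - x) * (1 + 2 * x)"
    proof -
      have "0 \<le> x * (1 - 2 * x)" using x by simp
      then show ?thesis by (simp add: algebra_simps)
    qed
    finally have "(\<Sum>j\<le>k. x ^ j) \<le> 1 + 2 * x"
      using x by simp
    also have "\<dots> \<le> exp (2 * x)" by (rule exp_ge_add_one_self)
    finally show ?thesis .
  qed
  then have "(\<Sum>j\<in>{..k}. x ^ j) ^ card {..<m} \<le> exp (2 * x) ^ m"
    using x by (simp add: power_mono sum_nonneg)
  also have "exp (2 * x) ^ m = exp (2 * real k)"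
    using k by (simp add: x_def flip: exp_of_nat_mult)
  finally show ?thesis
    using k x by (simp add: x_def power_divide field_simps)
qed

section \<open>Deviation bounds for row norms, images and excess\<close>

context gaussian_matrix
begin

text \<open>Chernoff bound for the squares divided by 4. The rate 3 survives a union over
  \<open>n * exp L\<close> rows when \<open>4 * L \<le> n\<close>.\<close>

lemma prob_row_norm:
  assumes "i < m"
  shows "prob {\<omega>\<in>space M. 16 * real n \<le> (\<Sum>j<n. (A i j \<omega>)\<^sup>2)} \<le> exp (- 3 * real n)"
proof -
  have "prob {\<omega>\<in>space M. 16 * real n \<le> (\<Sum>j<n. (A i j \<omega>)\<^sup>2)} =
      prob {\<omega>\<in>space M. 4 * real n \<le> (\<Sum>j<n. (A i j \<omega>)\<^sup>2 / 4)}"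
    by (intro arg_cong[where f = prob]) (auto simp flip: sum_divide_distrib)
  also have "\<dots> \<le> exp (- (4 * real n)) * sqrt 2 ^ card {..<n}"
    using assms by (intro chernoff_sum std_normal_exp_square_quarter normal
        indep_vars_compose2[OF indep_row[OF assms]]) auto
  also have "sqrt 2 \<le> exp 1"
    using real_le_lsqrt[of 2 2] exp_ge_add_one_self[of 1] by simp
  then have "exp (- (4 * real n)) * sqrt 2 ^ card {..<n} \<le> exp (- (4 * real n)) * exp 1 ^ n"
    by (simp add: power_mono)
  also have "\<dots> = exp (- 3 * real n)"
    by (simp flip: exp_of_nat_mult exp_add)
  finally show ?thesis .
qed

text \<open>After normalising \<open>z\<close> the image has independent standard Gaussian
  coordinates, and a negative exponential moment controls its small values. The rate 1 leaves room
  for a union over \<open>exp (n / 2)\<close> vectors.\<close>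

lemma prob_image_norm:
  assumes z: "L2_set z {..<m} \<noteq> 0"
  shows "prob {\<omega>\<in>space M. 36 * (\<Sum>j<n. (\<Sum>i<m. z i * A i j \<omega>)\<^sup>2) < real n * (\<Sum>i<m. (z i)\<^sup>2)} \<le> exp (- real n)"
proof -
  let ?r = "L2_set z {..<m}" and ?w = "\<lambda>i. z i / L2_set z {..<m}"
  have r: "?r > 0" using z L2_set_nonneg[of z "{..<m}"] by linarith
  \<comment> \<open>The constant 36 is a square for later use and is weakened to the 30 of the
    moment bound.\<close>
  have sub: "- real n \<le> (\<Sum>j<n. - 30 * (\<Sum>i<m. ?w i * A i j \<omega>)\<^sup>2)"
    if "36 * (\<Sum>j<n. (\<Sum>i<m. z i * A i j \<omega>)\<^sup>2) < real n * (\<Sum>i<m. (z i)\<^sup>2)" for \<omega>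
  proof -
    let ?Q = "\<Sum>j<n. (\<Sum>i<m. z i * A i j \<omega>)\<^sup>2"
    have "0 \<le> ?Q" by (simp add: sum_nonneg)
    then have "30 * ?Q \<le> real n * ?r\<^sup>2"
      using that by (simp add: L2_set_power2)
    then have "30 * ?Q / ?r\<^sup>2 \<le> real n"
      using r by (subst pos_divide_le_eq) simp_all
    then have "- real n \<le> - 30 * ?Q / ?r\<^sup>2"
      by simp
    moreover have "(\<Sum>j<n. - 30 * (\<Sum>i<m. ?w i * A i j \<omega>)\<^sup>2) = - 30 * ?Q / ?r\<^sup>2"
      by (simp add: power_divide sum_negf flip: sum_divide_distrib sum_distrib_left)
    ultimately show ?thesis
      by (simp only:)
  qed
  have "prob {\<omega>\<in>space M. 36 * (\<Sum>j<n. (\<Sum>i<m. z i * A i j \<omega>)\<^sup>2) < real n * (\<Sum>i<m. (z i)\<^sup>2)} \<le>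
      prob {\<omega>\<in>space M. - real n \<le> (\<Sum>j<n. - 30 * (\<Sum>i<m. ?w i * A i j \<omega>)\<^sup>2)}"
  proof (rule finite_measure_mono)
    show "{\<omega>\<in>space M. - real n \<le> (\<Sum>j<n. - 30 * (\<Sum>i<m. ?w i * A i j \<omega>)\<^sup>2)} \<in> events"
      by measurable
  qed (use sub in auto)
  also have "\<dots> \<le> exp (- (- real n)) * (1 / sqrt 61) ^ card {..<n}"
    by (intro chernoff_sum std_normal_exp_neg_square column_form_std_normal L2_set_normalize z
        indep_column_forms[where h = "\<lambda>s. - 30 * s\<^sup>2"]) auto
  also have "(1 / sqrt 61) ^ card {..<n} \<le> exp (- 2) ^ n"
  proof -
    have "exp 1 ^ 4 \<le> (272 / 100 :: real) ^ 4"
      by (intro power_mono less_imp_le[OF e_less_272]) auto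
    also have "\<dots> \<le> 61" by (simp add: power4_eq_xxxx)
    finally have "exp 2 \<le> sqrt (61::real)"
      by (intro real_le_rsqrt) (simp flip: exp_of_nat_mult)
    then have "1 / sqrt 61 \<le> exp (- 2 :: real)"
      by (simp add: exp_minus field_simps)
    then show ?thesis by (simp add: power_mono)
  qed
  also have "exp (- (- real n)) * exp (- 2) ^ n = exp (- real n)"
    by (simp flip: exp_of_nat_mult exp_add)
  finally show ?thesis by simp
qed

text \<open>With the factor 1/4 the exponential moment of each row differs from 1 by at most order
  \<open>exp (- \<tau>\<^sup>2 / 2)\<close>, so all rows together cost only the second term of the
  exponent.\<close>

lemma prob_excess:
  assumes c: "L2_set c {..<n} = 1" and \<tau>: "0 \<le> \<tau>"
  shows "prob {\<omega>\<in>space M. u \<le> excess m n \<tau> (\<lambda>i j. A i j \<omega>) c} \<le>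
    exp (- u / 4 + 2 * (real m * exp (- \<tau>\<^sup>2 / 2)))"
proof -
  let ?q = "exp (- \<tau>\<^sup>2 / 2)"
  have "prob {\<omega>\<in>space M. u \<le> excess m n \<tau> (\<lambda>i j. A i j \<omega>) c} =
      prob {\<omega>\<in>space M. u / 4 \<le> (\<Sum>i<m. (max 0 ((\<Sum>j<n. A i j \<omega> * c j) - \<tau>))\<^sup>2 / 4)}"
    by (intro arg_cong[where f = prob]) (auto simp: excess_def simp flip: sum_divide_distrib)
  also have "\<dots> \<le> exp (- (u / 4)) * (1 + sqrt 2 * ?q) ^ card {..<m}"
    by (intro chernoff_sum std_normal_exp_excess_square row_form_std_normal c \<tau>
        indep_row_forms[where h = "\<lambda>s _. (max 0 (s - \<tau>))\<^sup>2 / 4"]) auto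
  also have "(1 + sqrt 2 * ?q) ^ card {..<m} \<le> exp (2 * ?q) ^ m"
  proof -
    have "1 + sqrt 2 * ?q \<le> 1 + 2 * ?q"
      using real_le_lsqrt[of 2 2] by simp
    also have "\<dots> \<le> exp (2 * ?q)" by (rule exp_ge_add_one_self)
    finally show ?thesis by (simp add: power_mono)
  qed
  also have "exp (- (u / 4)) * exp (2 * ?q) ^ m = exp (- u / 4 + 2 * (real m * ?q))"
    by (simp add: algebra_simps flip: exp_of_nat_mult exp_add)
  finally show ?thesis by simp
qed

text \<open>A plain union bound over the rows, effective when \<open>m\<close> is so large that even
  a single exceedance is unlikely.\<close>

lemma prob_excess_pos:
  assumes c: "L2_set c {..<n} = 1" and \<tau>: "0 \<le> \<tau>"
  shows "prob {\<omega>\<in>space M. 0 < excess m n \<tau> (\<lambda>i j. A i j \<omega>) c} \<le> real m * exp (- \<tau>\<^sup>2 / 2)"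
proof -
  let ?E = "\<lambda>i. {\<omega>\<in>space M. \<tau> < (\<Sum>j<n. A i j \<omega> * c j)}"
  have meas: "?E i \<in> events" if "i < m" for i
    using measurable_row_form[OF that, of c] by measurable
  have "{\<omega>\<in>space M. 0 < excess m n \<tau> (\<lambda>i j. A i j \<omega>) c} \<subseteq> (\<Union>i<m. ?E i)"
  proof safe
    fix \<omega> assume "\<omega> \<in> space M" and pos: "0 < excess m n \<tau> (\<lambda>i j. A i j \<omega>) c"
    have "\<exists>i<m. \<tau> < (\<Sum>j<n. A i j \<omega> * c j)"
    proof (rule ccontr)
      assume "\<not> ?thesis"
      then have "excess m n \<tau> (\<lambda>i j. A i j \<omega>) c = 0"
        unfolding excess_def by (intro sum.neutral) (auto simp: max_def)
      with pos show False by simp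
    qed
    then show "\<omega> \<in> (\<Union>i<m. ?E i)" using \<open>\<omega> \<in> space M\<close> by auto
  qed
  then have "prob {\<omega>\<in>space M. 0 < excess m n \<tau> (\<lambda>i j. A i j \<omega>) c} \<le> prob (\<Union>i<m. ?E i)"
    using meas by (intro finite_measure_mono) auto
  also have "\<dots> \<le> (\<Sum>i<m. prob (?E i))"
    using meas by (intro finite_measure_subadditive_finite) auto
  also have "\<dots> \<le> (\<Sum>i<m. exp (- \<tau>\<^sup>2 / 2))"
    by (intro sum_mono std_normal_upper_tail row_form_std_normal c \<tau>) auto
  finally show ?thesis by simp
qed

end

text \<open>By duality a representation of \<open>(1 + 2 * \<epsilon>) * sqrt (2 * L)\<close> times
  \<open>c\<close> has to be refuted. The two alternatives match the regimes of very large and of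
  moderate \<open>m\<close>.\<close>

lemma support_function_ge:
  fixes a :: "nat \<Rightarrow> nat \<Rightarrow> real"
  assumes n: "1 \<le> n" and \<epsilon>: "0 < \<epsilon>" "\<epsilon> \<le> 1" and L: "0 < L"
    and c: "L2_set c {..<n} = 1"
    and small_excess: "excess m n ((1 + \<epsilon>) * sqrt (2 * L)) a c \<le> 0 \<or>
      (1 \<le> k \<and> real n \<le> 8 * L * real k \<and>
       (\<forall>i<m. (\<Sum>j<n. (a i j)\<^sup>2) \<le> 16 * real n) \<and>
       (\<forall>z :: nat \<Rightarrow> nat. (\<Sum>i<m. z i) = k \<longrightarrow>
          real n * (\<Sum>i<m. (real (z i))\<^sup>2) \<le> 36 * (\<Sum>j<n. (\<Sum>i<m. real (z i) * a i j)\<^sup>2)) \<and>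
       excess m n ((1 + \<epsilon>) * sqrt (2 * L)) a c \<le> (\<epsilon> / 100)\<^sup>2 * real n)"
  shows "ereal (1 / ((1 + 2 * \<epsilon>) * sqrt (2 * L))) \<le> support_function n (polyhedron_of m n a) c"
proof (rule polyhedron_duality)
  define s where "s = sqrt (2 * L)"
  define \<mu> where "\<mu> = (1 + 2 * \<epsilon>) * s"
  have s: "0 < s" using L by (simp add: s_def)
  have \<mu>: "0 < \<mu>" using s \<epsilon> by (simp add: \<mu>_def)
  show "0 < (1 + 2 * \<epsilon>) * sqrt (2 * L)" using \<mu> by (simp add: \<mu>_def s_def)
  fix y assume y: "\<And>i. i < m \<Longrightarrow> 0 \<le> y i" "(\<Sum>i<m. y i) \<le> 1"
    and eq: "\<And>j. j < n \<Longrightarrow> (\<Sum>i<m. y i * a i j) = (1 + 2 * \<epsilon>) * sqrt (2 * L) * c j"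
  define \<sigma> where "\<sigma> = (\<Sum>i<m. y i)"
  have "\<sigma> \<noteq> 0"
  proof
    assume "\<sigma> = 0"
    then have "\<forall>i\<in>{..<m}. y i = 0"
      unfolding \<sigma>_def using y by (subst (asm) sum_nonneg_eq_0_iff) auto
    then have "\<mu> * c j = 0" if "j < n" for j
      using eq[OF that] by (simp add: \<mu>_def s_def)
    then have "L2_set c {..<n} = 0"
      using \<mu> by (subst L2_set_eq_0_iff) auto
    with c show False by simp
  qed
  moreover have "0 \<le> \<sigma>" unfolding \<sigma>_def using y by (intro sum_nonneg) auto
  ultimately have \<sigma>: "0 < \<sigma>" "\<sigma> \<le> 1" using y by (auto simp: \<sigma>_def)
  \<comment> \<open>Rescaling to total weight 1 can only raise the target from \<open>\<mu>\<close>
    to \<open>\<nu>\<close>.\<close>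
  define w where "w i = y i / \<sigma>" for i
  define \<nu> where "\<nu> = \<mu> / \<sigma>"
  have w: "\<And>i. i < m \<Longrightarrow> 0 \<le> w i" "(\<Sum>i<m. w i) = 1"
    using y \<sigma> by (auto simp: w_def \<sigma>_def simp flip: sum_divide_distrib)
  have weq: "(\<Sum>i<m. w i * a i j) = \<nu> * c j" if "j < n" for j
    using eq[OF that] by (simp add: w_def \<nu>_def \<mu>_def s_def flip: sum_divide_distrib)
  have \<nu>: "\<mu> \<le> \<nu>" "0 < \<nu>"
    using \<sigma> \<mu> by (auto simp: \<nu>_def le_divide_eq)
  let ?E = "excess m n ((1 + \<epsilon>) * s) a c"
  have main: "\<nu> \<le> (1 + \<epsilon>) * s + L2_set w {..<m} * sqrt ?E"
    by (rule combination_le_excess[OF w c weq])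
  have E0: "0 \<le> ?E" by (rule excess_nonneg)
  have \<tau>\<mu>: "(1 + \<epsilon>) * s < \<mu>" using s \<epsilon> by (simp add: \<mu>_def)
  from small_excess show False
  proof
    assume "excess m n ((1 + \<epsilon>) * sqrt (2 * L)) a c \<le> 0"
    then have "?E = 0" using E0 by (simp add: s_def)
    then show False using main \<nu> \<tau>\<mu> by simp
  next
    assume *: "1 \<le> k \<and> real n \<le> 8 * L * real k \<and>
       (\<forall>i<m. (\<Sum>j<n. (a i j)\<^sup>2) \<le> 16 * real n) \<and>
       (\<forall>z :: nat \<Rightarrow> nat. (\<Sum>i<m. z i) = k \<longrightarrow>
          real n * (\<Sum>i<m. (real (z i))\<^sup>2) \<le> 36 * (\<Sum>j<n. (\<Sum>i<m. real (z i) * a i j)\<^sup>2)) \<and>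
       excess m n ((1 + \<epsilon>) * sqrt (2 * L)) a c \<le> (\<epsilon> / 100)\<^sup>2 * real n"
    then have k: "1 \<le> k" by blast
    have "sqrt (real n) * L2_set w {..<m} \<le>
        6 * L2_set (\<lambda>j. \<Sum>i<m. w i * a i j) {..<n} + 7 * sqrt (17 * real n / real k)"
      using * by (intro L2_set_le_of_sparse_isometry n k w) auto
    also have "L2_set (\<lambda>j. \<Sum>i<m. w i * a i j) {..<n} = L2_set (\<lambda>j. \<nu> * c j) {..<n}"
      by (intro L2_set_cong) (auto simp: weq)
    also have "\<dots> = \<nu>" using \<nu> c by (simp add: L2_set_scale)
    \<comment> \<open>Since \<open>17 * 8 = 136\<close> is at most
      \<open>81 * 2 = 162\<close>.\<close>
    also have "sqrt (17 * real n / real k) \<le> 9 * s"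
    proof (rule real_le_lsqrt)
      have "17 * real n / real k \<le> 17 * (8 * L)"
        using * by (simp add: divide_le_eq)
      also have "\<dots> \<le> (9 * s)\<^sup>2" using L by (simp add: s_def power_mult_distrib)
      finally show "17 * real n / real k \<le> (9 * s)\<^sup>2" .
    qed (use s in auto)
    finally have nw: "sqrt (real n) * L2_set w {..<m} \<le> 6 * \<nu> + 63 * s" by simp
    have "sqrt ?E \<le> sqrt ((\<epsilon> / 100)\<^sup>2 * real n)"
      using * by (simp add: s_def)
    also have "\<dots> = \<epsilon> / 100 * sqrt (real n)"
      using \<epsilon> by (simp add: real_sqrt_mult)
    finally have "L2_set w {..<m} * sqrt ?E \<le> L2_set w {..<m} * (\<epsilon> / 100 * sqrt (real n))"
      by (rule mult_left_mono) simp
    also have "\<dots> = \<epsilon> / 100 * (sqrt (real n) * L2_set w {..<m})" by simp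
    also have "\<dots> \<le> \<epsilon> / 100 * (6 * \<nu> + 63 * s)"
      using nw \<epsilon> by (intro mult_left_mono) auto
    finally have "\<nu> \<le> (1 + \<epsilon>) * s + \<epsilon> / 100 * (6 * \<nu> + 63 * s)"
      using main by linarith
    then have "(1 - 6 * (\<epsilon> / 100)) * \<nu> \<le> (1 + \<epsilon> + 63 * (\<epsilon> / 100)) * s"
      by (simp add: algebra_simps)
    moreover have "(1 - 6 * (\<epsilon> / 100)) * \<mu> \<le> (1 - 6 * (\<epsilon> / 100)) * \<nu>"
      using \<nu> \<epsilon> by (intro mult_left_mono) auto
    \<comment> \<open>With 63 = 7 * 9 the left factor is \<open>1 + 1.63 * \<epsilon>\<close> and
      the right one at least \<open>1 + 1.82 * \<epsilon>\<close>; the division by 100 provides this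
      margin.\<close>
    moreover have "(1 + \<epsilon> + 63 * (\<epsilon> / 100)) * s < (1 - 6 * (\<epsilon> / 100)) * \<mu>"
    proof -
      have "\<epsilon> * \<epsilon> \<le> \<epsilon>" using \<epsilon> mult_left_mono[of \<epsilon> 1 \<epsilon>] by simp
      moreover have "(1 - 6 * (\<epsilon> / 100)) * (1 + 2 * \<epsilon>) = 1 + 2 * \<epsilon> - 6 * \<epsilon> / 100 - 12 * (\<epsilon> * \<epsilon>) / 100"
        by (simp add: field_simps)
      ultimately have "1 + \<epsilon> + 63 * (\<epsilon> / 100) < (1 - 6 * (\<epsilon> / 100)) * (1 + 2 * \<epsilon>)"
        using \<epsilon> by linarith
      then show ?thesis using s by (simp add: \<mu>_def mult.assoc[symmetric])
    qed
    ultimately show False by linarith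
  qed
qed

section \<open>Simultaneous control of sparse vectors and of most directions\<close>

context gaussian_matrix
begin

lemma sparse_isometry_whp:
  assumes n: "1 \<le> n" and m: "real m = real n * exp L" and L: "32 \<le> L" "4 * L \<le> real n"
  obtains B k where "B \<in> events" "prob B \<le> 2 * exp (- real n / 2)" "1 \<le> k" "real n \<le> 8 * L * real k"
    "\<And>\<omega> i. \<omega> \<in> space M - B \<Longrightarrow> i < m \<Longrightarrow> (\<Sum>j<n. (A i j \<omega>)\<^sup>2) \<le> 16 * real n"
    "\<And>\<omega> z. \<omega> \<in> space M - B \<Longrightarrow> (\<Sum>i<m. z i) = k \<Longrightarrow>
      real n * (\<Sum>i<m. (real (z i))\<^sup>2) \<le> 36 * (\<Sum>j<n. (\<Sum>i<m. real (z i) * A i j \<omega>)\<^sup>2)"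
proof -
  \<comment> \<open>The condition \<open>4 * L \<le> n\<close> makes \<open>k\<close> positive, so
    rounding down loses at most a factor 2. The value keeps the number of compositions below
    \<open>exp (n / 2)\<close>.\<close>
  define k where "k = nat \<lfloor>real n / (4 * L)\<rfloor>"
  have ge1: "1 \<le> real n / (4 * L)" using L by (simp add: le_divide_eq)
  then have k: "1 \<le> k" by (simp add: k_def le_nat_iff)
  have k_le: "real k \<le> real n / (4 * L)" using ge1 by (simp add: k_def)
  have "real n / (4 * L) \<le> 2 * real k"
    using ge1 k unfolding k_def by linarith
  then have nk: "real n \<le> 8 * L * real k" using L by (simp add: divide_le_eq mult_ac)
  define E where "E i = {\<omega>\<in>space M. 16 * real n \<le> (\<Sum>j<n. (A i j \<omega>)\<^sup>2)}" for i
  define F where "F z = {\<omega>\<in>space M. 36 * (\<Sum>j<n. (\<Sum>i<m. real (z i) * A i j \<omega>)\<^sup>2) <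
      real n * (\<Sum>i<m. (real (z i))\<^sup>2)}" for z :: "nat \<Rightarrow> nat"
  define Z where "Z = {z \<in> {..<m} \<rightarrow>\<^sub>E {..k}. (\<Sum>i<m. z i) = k}"
  have finZ: "finite Z"
    unfolding Z_def by (rule finite_subset[of _ "{..<m} \<rightarrow>\<^sub>E {..k}"]) (auto intro!: finite_PiE)
  have E: "E i \<in> events" if "i < m" for i
    unfolding E_def using that by measurable
  have F: "F z \<in> events" for z
    unfolding F_def by measurable
  define B where "B = (\<Union>i<m. E i) \<union> (\<Union>z\<in>Z. F z)"
  have "prob (\<Union>i<m. E i) \<le> (\<Sum>i<m. prob (E i))"
    using E by (intro finite_measure_subadditive_finite) auto
  also have "\<dots> \<le> (\<Sum>i<m. exp (- 3 * real n))"
    unfolding E_def by (intro sum_mono prob_row_norm) auto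
  also have "\<dots> = real n * (exp L * exp (- 3 * real n))" by (simp add: m)
  also have "real n \<le> exp (real n)"
    using exp_ge_add_one_self[of "real n"] by linarith
  then have "real n * (exp L * exp (- 3 * real n)) \<le> exp (real n) * (exp L * exp (- 3 * real n))"
    by (rule mult_right_mono) simp
  also have "\<dots> = exp (real n + L - 3 * real n)" by (simp add: algebra_simps flip: exp_add)
  also have "\<dots> \<le> exp (- real n / 2)" using L by simp
  finally have 1: "prob (\<Union>i<m. E i) \<le> exp (- real n / 2)" .
  have mpos: "0 < real m" using m n by simp
  have "prob (\<Union>z\<in>Z. F z) \<le> (\<Sum>z\<in>Z. prob (F z))"
    using F finZ by (intro finite_measure_subadditive_finite) auto
  also have "\<dots> \<le> (\<Sum>z\<in>Z. exp (- real n))"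
  proof (rule sum_mono)
    fix z assume z: "z \<in> Z"
    have "L2_set (\<lambda>i. real (z i)) {..<m} \<noteq> 0"
    proof
      assume "L2_set (\<lambda>i. real (z i)) {..<m} = 0"
      then have "(\<Sum>i<m. z i) = 0" by (subst (asm) L2_set_eq_0_iff) auto
      with z k show False by (simp add: Z_def)
    qed
    then show "prob (F z) \<le> exp (- real n)"
      unfolding F_def by (rule prob_image_norm)
  qed
  also have "\<dots> = real (card Z) * exp (- real n)" by simp
  also have "real (card Z) \<le> exp (real n / 2)"
  proof -
    have "2 * k \<le> m"
    proof -
      have "2 * real k \<le> 2 * (real n / (4 * L))" using k_le by simp
      also have "\<dots> \<le> real n * 1" using L by (simp add: divide_le_eq)
      also have "\<dots> \<le> real n * exp L" using L by (intro mult_left_mono) auto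
      finally show ?thesis using m by linarith
    qed
    then have "real (card Z) \<le> (real m / real k) ^ k * exp (2 * real k)"
      unfolding Z_def by (rule card_compositions_le[OF k])
    also have "(real m / real k) ^ k \<le> (8 * L * exp L) ^ k"
    proof (rule power_mono)
      have "real n * exp L \<le> 8 * L * real k * exp L"
        using nk by (intro mult_right_mono) auto
      then show "real m / real k \<le> 8 * L * exp L"
        using k by (simp add: m divide_le_eq mult_ac)
    qed simp
    also have "(8 * L * exp L) ^ k = exp (real k * (ln (8 * L) + L))"
      using L by (simp add: exp_of_nat_mult exp_add)
    also have "exp (real k * (ln (8 * L) + L)) * exp (2 * real k) = exp (real k * (ln (8 * L) + 2 + L))"
      by (simp add: algebra_simps flip: exp_add)
    also have "\<dots> \<le> exp (real n / 2)"
    proof -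
      \<comment> \<open>The logarithm of the square root is at most the root minus 1, and the root
        is at most \<open>L / 2\<close> once \<open>L \<ge> 32\<close>.\<close>
      have "ln (8 * L) + 2 \<le> L"
      proof -
        have "ln (8 * L) = 2 * ln (sqrt (8 * L))" using L by (simp add: ln_sqrt)
        also have "ln (sqrt (8 * L)) \<le> sqrt (8 * L) - 1" using L by (intro ln_le_minus_one) simp
        also have "sqrt (8 * L) \<le> L / 2"
        proof (rule real_le_lsqrt)
          have "0 \<le> L * (L - 32)" using L by simp
          then show "8 * L \<le> (L / 2)\<^sup>2" by (simp add: power2_eq_square algebra_simps)
        qed (use L in auto)
        finally show ?thesis by simp
      qed
      then have "real k * (ln (8 * L) + 2 + L) \<le> real n / (4 * L) * (2 * L)"
        using k_le L by (intro mult_mono) auto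
      also have "\<dots> = real n / 2" using L by simp
      finally show ?thesis by simp
    qed
    finally show ?thesis by simp
  qed
  then have "real (card Z) * exp (- real n) \<le> exp (real n / 2) * exp (- real n)"
    by (rule mult_right_mono) simp
  also have "\<dots> = exp (- real n / 2)" by (simp flip: exp_add)
  finally have 2: "prob (\<Union>z\<in>Z. F z) \<le> exp (- real n / 2)" .
  show ?thesis
  proof (rule that)
    show "B \<in> events" unfolding B_def using E F finZ by auto
    have "prob B \<le> prob (\<Union>i<m. E i) + prob (\<Union>z\<in>Z. F z)"
      unfolding B_def using E F finZ by (intro measure_Un_le) auto
    then show "prob B \<le> 2 * exp (- real n / 2)" using 1 2 by simp
    show "1 \<le> k" "real n \<le> 8 * L * real k" by (fact k, fact nk)
    fix \<omega> assume \<omega>: "\<omega> \<in> space M - B"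
    show "(\<Sum>j<n. (A i j \<omega>)\<^sup>2) \<le> 16 * real n" if "i < m" for i
      using \<omega> that by (force simp: B_def E_def)
    fix z :: "nat \<Rightarrow> nat" assume z: "(\<Sum>i<m. z i) = k"
    \<comment> \<open>Only the values below \<open>m\<close> matter; restricting to them lands in
      the finite set \<open>Z\<close> of the union bound.\<close>
    define z' where "z' = (\<lambda>i\<in>{..<m}. z i)"
    have "z i \<le> k" if "i < m" for i
      using that z member_le_sum[of i "{..<m}" z] by auto
    then have "z' \<in> Z" using z by (auto simp: Z_def z'_def)
    then have "\<omega> \<notin> F z'" using \<omega> by (auto simp: B_def)
    then show "real n * (\<Sum>i<m. (real (z i))\<^sup>2) \<le> 36 * (\<Sum>j<n. (\<Sum>i<m. real (z i) * A i j \<omega>)\<^sup>2)"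
      using \<omega> by (simp add: F_def z'_def not_less)
  qed
qed

text \<open>By Fubini the expected measure of bad directions is the average over \<open>c\<close> of
  the failure probability, hence at most \<open>\<beta>\<close>; Markov's inequality then bounds the
  chance that it reaches \<open>\<epsilon>\<close>.\<close>

lemma prob_measure_excess:
  fixes N :: "(nat \<Rightarrow> real) measure"
  assumes "prob_space N" and sets_N: "sets N = sets (\<Pi>\<^sub>M i\<in>{..<n}. borel)"
    and unit: "AE c in N. L2_set c {..<n} = 1"
    and bound: "\<And>c. L2_set c {..<n} = 1 \<Longrightarrow> prob {\<omega>\<in>space M. \<kappa> < excess m n \<tau> (\<lambda>i j. A i j \<omega>) c} \<le> \<beta>"
    and \<epsilon>: "0 < \<epsilon>" and \<beta>: "0 \<le> \<beta>"
  shows "{\<omega>\<in>space M. \<epsilon> \<le> measure N {c\<in>space N. \<kappa> < excess m n \<tau> (\<lambda>i j. A i j \<omega>) c}} \<in> events" (is "?B \<in> _")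
    and "prob {\<omega>\<in>space M. \<epsilon> \<le> measure N {c\<in>space N. \<kappa> < excess m n \<tau> (\<lambda>i j. A i j \<omega>) c}} \<le> \<beta> / \<epsilon>"
proof -
  interpret N: prob_space N by fact
  interpret P: pair_sigma_finite M N ..
  note [measurable_cong] = sets_N
  define Q where "Q = {p\<in>space (M \<Otimes>\<^sub>M N). \<kappa> < excess m n \<tau> (\<lambda>i j. A i j (fst p)) (snd p)}"
  have [measurable]: "(\<lambda>p. A i j (fst p) * snd p j) \<in> borel_measurable (M \<Otimes>\<^sub>M N)" if "i < m" "j < n" for i j
  proof -
    have [measurable]: "A i j \<in> borel_measurable M" using that by (rule measurable_entry)
    have [measurable]: "(\<lambda>c. c j) \<in> borel_measurable N"
      using that measurable_component_singleton[of j "{..<n}" "\<lambda>_. borel :: real measure"]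
      by (simp cong: measurable_cong_sets add: sets_N)
    show ?thesis by measurable
  qed
  have Q: "Q \<in> sets (M \<Otimes>\<^sub>M N)"
    unfolding Q_def excess_def by measurable
  define D where "D \<omega> = {c\<in>space N. \<kappa> < excess m n \<tau> (\<lambda>i j. A i j \<omega>) c}" for \<omega>
  have D: "Pair \<omega> -` Q = D \<omega>" if "\<omega> \<in> space M" for \<omega>
    using that by (auto simp: Q_def D_def space_pair_measure)
  have D_meas: "(\<lambda>\<omega>. emeasure N (D \<omega>)) \<in> borel_measurable M"
    using N.measurable_emeasure_Pair[OF Q] by (rule measurable_cong[THEN iffD1, rotated]) (simp add: D)
  then have D_meas': "(\<lambda>\<omega>. measure N (D \<omega>)) \<in> borel_measurable M"
    unfolding measure_def by measurable
  then show "?B \<in> events"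
    unfolding D_def[symmetric] by measurable
  have "(\<integral>\<^sup>+\<omega>. emeasure N (D \<omega>) \<partial>M) = emeasure (M \<Otimes>\<^sub>M N) Q"
    by (subst N.emeasure_pair_measure_alt[OF Q]) (auto intro!: nn_integral_cong simp: D)
  also have "\<dots> = (\<integral>\<^sup>+c. emeasure M ((\<lambda>\<omega>. (\<omega>, c)) -` Q) \<partial>N)"
    by (rule P.emeasure_pair_measure_alt2[OF Q])
  also have "\<dots> \<le> (\<integral>\<^sup>+c. ennreal \<beta> \<partial>N)"
  proof (rule nn_integral_mono_AE)
    from unit AE_space show "AE c in N. emeasure M ((\<lambda>\<omega>. (\<omega>, c)) -` Q) \<le> ennreal \<beta>"
    proof eventually_elim
      case (elim c)
      then have "(\<lambda>\<omega>. (\<omega>, c)) -` Q = {\<omega>\<in>space M. \<kappa> < excess m n \<tau> (\<lambda>i j. A i j \<omega>) c}"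
        by (auto simp: Q_def space_pair_measure)
      then show ?case
        using bound[OF elim(1)] \<beta> by (simp add: emeasure_eq_measure ennreal_leI)
    qed
  qed
  also have "\<dots> = ennreal \<beta>" by (simp add: N.emeasure_space_1)
  finally have int: "(\<integral>\<^sup>+\<omega>. emeasure N (D \<omega>) \<partial>M) \<le> ennreal \<beta>" .
  \<comment> \<open>Markov's inequality is applied at level 1 to the measure scaled by
    \<open>1 / \<epsilon>\<close>.\<close>
  have "1 \<le> ennreal (1 / \<epsilon>) * emeasure N (D \<omega>) \<longleftrightarrow> \<epsilon> \<le> measure N (D \<omega>)" for \<omega>
  proof -
    have "ennreal (1 / \<epsilon>) * emeasure N (D \<omega>) = ennreal (measure N (D \<omega>) / \<epsilon>)"
      using \<epsilon> by (simp add: N.emeasure_eq_measure flip: ennreal_mult)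
    then show ?thesis
      using \<epsilon> by (simp add: le_divide_eq flip: ennreal_1)
  qed
  then have "emeasure M ?B = emeasure M {\<omega>\<in>space M. 1 \<le> ennreal (1 / \<epsilon>) * emeasure N (D \<omega>)}"
    by (simp add: D_def)
  also have "\<dots> \<le> ennreal (1 / \<epsilon>) * (\<integral>\<^sup>+\<omega>. emeasure N (D \<omega>) * indicator (space M) \<omega> \<partial>M)"
    using D_meas by (intro nn_integral_Markov_inequality) auto
  also have "\<dots> \<le> ennreal (1 / \<epsilon>) * ennreal \<beta>"
    using int by (intro mult_left_mono) (auto cong: nn_integral_cong)
  also have "\<dots> = ennreal (\<beta> / \<epsilon>)"
    using \<epsilon> \<beta> by (simp flip: ennreal_mult)
  finally show "prob ?B \<le> \<beta> / \<epsilon>"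
    using \<epsilon> \<beta> by (simp add: emeasure_eq_measure)
qed

end

section \<open>Mean width from bounds on the support function\<close>

lemma mean_width_le:
  assumes n: "1 \<le> n" and \<rho>: "0 \<le> \<rho>" and P: "\<And>x. x \<in> P \<Longrightarrow> L2_set x {..<n} \<le> \<rho>"
  shows "mean_width n P \<le> ennreal (2 * \<rho>)"
proof -
  interpret prob_space "uniform_sphere n" by (rule prob_space_uniform_sphere[OF n])
  have "(\<integral>\<^sup>+c. e2ennreal (support_function n P c) \<partial>uniform_sphere n) \<le> (\<integral>\<^sup>+c. ennreal \<rho> \<partial>uniform_sphere n)"
  proof (rule nn_integral_mono_AE)
    from AE_uniform_sphere[OF n]
    show "AE c in uniform_sphere n. e2ennreal (support_function n P c) \<le> ennreal \<rho>"
    proof eventually_elim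
      case (elim c)
      have "support_function n P c \<le> ereal \<rho>"
        unfolding support_function_def
      proof (rule SUP_least)
        fix x assume x: "x \<in> P"
        have "inner_prod n c x \<le> L2_set c {..<n} * L2_set x {..<n}"
          unfolding inner_prod_def by (rule sum_mult_le_L2_set)
        then show "ereal (inner_prod n c x) \<le> ereal \<rho>"
          using elim P[OF x] by (simp add: unit_sphere_def)
      qed
      then show ?case
        using e2ennreal_mono by (fastforce simp flip: e2ennreal_ereal)
    qed
  qed
  also have "\<dots> = ennreal \<rho>" by (simp add: emeasure_space_1)
  finally have "mean_width n P \<le> 2 * ennreal \<rho>"
    unfolding mean_width_def by (rule mult_left_mono) simp
  then show ?thesis using \<rho> by (simp add: ennreal_mult)
qed

text \<open>The integrand is \<open>ennreal\<close>-valued, so directions outside \<open>G\<close>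
  contribute at least 0.\<close>

lemma mean_width_ge:
  assumes n: "1 \<le> n" and r: "0 \<le> r" and G: "G \<in> sets (uniform_sphere n)"
    and \<theta>: "0 \<le> \<theta>" "\<theta> \<le> measure (uniform_sphere n) G"
    and P: "\<And>c. c \<in> G \<Longrightarrow> L2_set c {..<n} = 1 \<Longrightarrow> ereal r \<le> support_function n P c"
  shows "ennreal (2 * r * \<theta>) \<le> mean_width n P"
proof -
  interpret prob_space "uniform_sphere n" by (rule prob_space_uniform_sphere[OF n])
  have "ennreal r * ennreal \<theta> \<le> ennreal r * emeasure (uniform_sphere n) G"
    using \<theta> by (intro mult_left_mono) (auto simp: emeasure_eq_measure ennreal_leI)
  also have "\<dots> = (\<integral>\<^sup>+c. ennreal r * indicator G c \<partial>uniform_sphere n)"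
    using G by (simp add: nn_integral_cmult_indicator)
  also have "\<dots> \<le> (\<integral>\<^sup>+c. e2ennreal (support_function n P c) \<partial>uniform_sphere n)"
  proof (rule nn_integral_mono_AE)
    from AE_uniform_sphere[OF n]
    show "AE c in uniform_sphere n. ennreal r * indicator G c \<le> e2ennreal (support_function n P c)"
    proof eventually_elim
      case (elim c)
      then show ?case
        using P[of c] e2ennreal_mono by (fastforce simp: unit_sphere_def indicator_def simp flip: e2ennreal_ereal)
    qed
  qed
  finally have "2 * (ennreal r * ennreal \<theta>) \<le> mean_width n P"
    unfolding mean_width_def by (rule mult_left_mono) simp
  then show ?thesis using r \<theta> by (simp add: ennreal_mult mult.assoc)
qed

section \<open>Almost sure convergence\<close>

context prob_space
begin

text \<open>Borel-Cantelli: the bad events have geometrically summable probabilities.\<close>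

lemma AE_eventually_of_exponential_bound:
  fixes \<alpha> C :: real
  assumes \<alpha>: "0 < \<alpha>"
    and "\<forall>\<^sub>F n in sequentially. \<exists>B\<in>events. prob B \<le> C * exp (- \<alpha> * real n) \<and> (\<forall>\<omega>\<in>space M - B. P n \<omega>)"
  shows "AE \<omega> in M. \<forall>\<^sub>F n in sequentially. P n \<omega>"
proof -
  obtain N where N: "\<And>n. n \<ge> N \<Longrightarrow>
      \<exists>B\<in>events. prob B \<le> C * exp (- \<alpha> * real n) \<and> (\<forall>\<omega>\<in>space M - B. P n \<omega>)"
    using assms(2) by (auto simp: eventually_sequentially)
  then obtain B' where B': "\<And>n. n \<ge> N \<Longrightarrow> B' n \<in> events" "\<And>n. n \<ge> N \<Longrightarrow> prob (B' n) \<le> C * exp (- \<alpha> * real n)"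
      "\<And>n \<omega>. n \<ge> N \<Longrightarrow> \<omega> \<in> space M - B' n \<Longrightarrow> P n \<omega>"
    by metis
  define B where "B n = (if n \<ge> N then B' n else {})" for n
  have "summable (\<lambda>n. prob (B n))"
  proof (rule summable_comparison_test')
    have "norm (exp (- \<alpha>)) < 1" using \<alpha> by simp
    then have "summable (\<lambda>n. C * exp (- \<alpha>) ^ n)"
      by (intro summable_mult summable_geometric)
    then show "summable (\<lambda>n. C * exp (- \<alpha> * real n))"
      by (simp add: mult.commute flip: exp_of_nat_mult)
    show "norm (prob (B n)) \<le> C * exp (- \<alpha> * real n)" if "n \<ge> N" for n
      using B'(2)[OF that] that by (simp add: B_def)
  qed
  then have "AE \<omega> in M. \<forall>\<^sub>F n in sequentially. \<omega> \<in> space M - B n"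
    using B'(1) by (intro borel_cantelli_AE1) (auto simp: B_def emeasure_eq_measure)
  then show ?thesis
  proof eventually_elim
    case (elim \<omega>)
    then show ?case
      using eventually_ge_at_top[of N] by eventually_elim (auto simp: B_def intro: B'(3))
  qed
qed

text \<open>
  If \<open>4 ln (m / n) \<le> n\<close>, the excess is compared with the sparse isometry. Otherwise no row at all has
  \<open>\<langle>a\<^sub>i, c\<rangle> > \<tau>\<close> with overwhelming probability.
\<close>

lemma support_function_ge_whp:
  fixes \<epsilon> :: real
  assumes \<epsilon>: "0 < \<epsilon>" "\<epsilon> \<le> 1"
  obtains L\<^sub>0 :: real where "\<And>m n A. gaussian_matrix M m n A \<Longrightarrow> 1 \<le> n \<Longrightarrow> L\<^sub>0 \<le> ln (real m / real n) \<Longrightarrow>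
    \<exists>B\<in>events. \<exists>\<kappa>. prob B \<le> 2 * exp (- (\<epsilon>\<^sup>2 / 80000) * real n) \<and>
      (\<forall>\<omega>\<in>space M - B. \<forall>c. L2_set c {..<n} = 1 \<longrightarrow>
         excess m n ((1 + \<epsilon>) * sqrt (2 * ln (real m / real n))) (\<lambda>i j. A i j \<omega>) c \<le> \<kappa> \<longrightarrow>
         ereal (1 / ((1 + 2 * \<epsilon>) * sqrt (2 * ln (real m / real n)))) \<le>
           support_function n (polyhedron_of m n (\<lambda>i j. A i j \<omega>)) c) \<and>
      (\<forall>c. L2_set c {..<n} = 1 \<longrightarrow>
         prob {\<omega>\<in>space M. \<kappa> < excess m n ((1 + \<epsilon>) * sqrt (2 * ln (real m / real n))) (\<lambda>i j. A i j \<omega>) c}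
           \<le> exp (- (\<epsilon>\<^sup>2 / 80000) * real n))"
proof (rule that)
  define \<eta> where "\<eta> = \<epsilon> / 100"
  have \<eta>: "0 < \<eta>" using \<epsilon> by (simp add: \<eta>_def)
  \<comment> \<open>Equal to \<open>\<eta>\<^sup>2 / 8\<close>, the rate left when the expected
    excess takes half of the Chernoff exponent \<open>\<eta>\<^sup>2 / 4\<close>.\<close>
  define \<alpha> where "\<alpha> = \<epsilon>\<^sup>2 / 80000"
  have eps2: "\<epsilon>\<^sup>2 \<le> \<epsilon>" using \<epsilon> mult_left_mono[of \<epsilon> 1 \<epsilon>] by (simp add: power2_eq_square)
  fix m n :: nat and A :: "nat \<Rightarrow> nat \<Rightarrow> 'a \<Rightarrow> real"
  assume "gaussian_matrix M m n A" and n: "1 \<le> n"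
    and L0: "max (max 32 (8 / \<epsilon>\<^sup>2)) (8 / (\<epsilon> * (\<epsilon> / 100)\<^sup>2)) \<le> ln (real m / real n)"
  interpret gaussian_matrix M m n A by fact
  define L where "L = ln (real m / real n)"
  \<comment> \<open>The bound 32 serves the sparse isometry, the second one the regime
    \<open>n < 4 * L\<close>, and the third one makes the excess small when
    \<open>4 * L \<le> n\<close>.\<close>
  have L: "32 \<le> L" "8 / \<epsilon>\<^sup>2 \<le> L" "8 / (\<epsilon> * \<eta>\<^sup>2) \<le> L"
    using L0 by (auto simp: L_def \<eta>_def)
  have "m \<noteq> 0"
    using L(1) by (cases "m = 0") (auto simp: L_def)
  then have m: "real m = real n * exp L"
    using n by (simp add: L_def)
  define \<tau> where "\<tau> = (1 + \<epsilon>) * sqrt (2 * L)"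
  have \<tau>: "0 \<le> \<tau>" using \<epsilon> L by (simp add: \<tau>_def)
  have m\<tau>: "real m * exp (- \<tau>\<^sup>2 / 2) \<le> real n * exp (- 2 * \<epsilon> * L)"
  proof -
    have "\<tau>\<^sup>2 / 2 = (1 + \<epsilon>)\<^sup>2 * L" using L by (simp add: \<tau>_def power_mult_distrib)
    also have "\<dots> \<ge> (1 + 2 * \<epsilon>) * L"
      using L by (intro mult_right_mono) (auto simp: power2_eq_square algebra_simps)
    finally have "exp (L + - \<tau>\<^sup>2 / 2) \<le> exp (- 2 * \<epsilon> * L)" by (simp add: algebra_simps)
    then show ?thesis
      unfolding m mult.assoc exp_add[symmetric] by (rule mult_left_mono) simp
  qed
  have "\<exists>B\<in>events. \<exists>\<kappa>. prob B \<le> 2 * exp (- \<alpha> * real n) \<and>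
      (\<forall>\<omega>\<in>space M - B. \<forall>c. L2_set c {..<n} = 1 \<longrightarrow> excess m n \<tau> (\<lambda>i j. A i j \<omega>) c \<le> \<kappa> \<longrightarrow>
         ereal (1 / ((1 + 2 * \<epsilon>) * sqrt (2 * L))) \<le> support_function n (polyhedron_of m n (\<lambda>i j. A i j \<omega>)) c) \<and>
      (\<forall>c. L2_set c {..<n} = 1 \<longrightarrow>
         prob {\<omega>\<in>space M. \<kappa> < excess m n \<tau> (\<lambda>i j. A i j \<omega>) c} \<le> exp (- \<alpha> * real n))"
  proof (cases "4 * L \<le> real n")
    case True
    obtain B k where B: "B \<in> events" "prob B \<le> 2 * exp (- real n / 2)" and k: "1 \<le> k" "real n \<le> 8 * L * real k"
      and rows: "\<And>\<omega> i. \<omega> \<in> space M - B \<Longrightarrow> i < m \<Longrightarrow> (\<Sum>j<n. (A i j \<omega>)\<^sup>2) \<le> 16 * real n"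
      and sparse: "\<And>\<omega> z. \<omega> \<in> space M - B \<Longrightarrow> (\<Sum>i<m. z i) = k \<Longrightarrow>
        real n * (\<Sum>i<m. (real (z i))\<^sup>2) \<le> 36 * (\<Sum>j<n. (\<Sum>i<m. real (z i) * A i j \<omega>)\<^sup>2)"
      by (rule sparse_isometry_whp[OF n m L(1) True]) blast
    have "\<alpha> \<le> 1 / 2" using eps2 \<epsilon> by (simp add: \<alpha>_def)
    then have "\<alpha> * real n \<le> 1 / 2 * real n" by (rule mult_right_mono) simp
    then have "prob B \<le> 2 * exp (- \<alpha> * real n)"
      by (intro order.trans[OF B(2)]) simp
    moreover have "ereal (1 / ((1 + 2 * \<epsilon>) * sqrt (2 * L))) \<le> support_function n (polyhedron_of m n (\<lambda>i j. A i j \<omega>)) c"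
      if "\<omega> \<in> space M - B" "L2_set c {..<n} = 1" "excess m n \<tau> (\<lambda>i j. A i j \<omega>) c \<le> \<eta>\<^sup>2 * real n" for \<omega> c
      using that L k rows sparse by (intro support_function_ge[OF n \<epsilon>] disjI2[where P = "_ \<le> 0"])
        (auto simp: \<tau>_def \<eta>_def)
    moreover have "prob {\<omega>\<in>space M. \<eta>\<^sup>2 * real n < excess m n \<tau> (\<lambda>i j. A i j \<omega>) c} \<le> exp (- \<alpha> * real n)"
      if c: "L2_set c {..<n} = 1" for c
    proof -
      have meas: "{\<omega>\<in>space M. \<eta>\<^sup>2 * real n \<le> excess m n \<tau> (\<lambda>i j. A i j \<omega>) c} \<in> events"
        unfolding excess_def by measurable
      have "16 / \<eta>\<^sup>2 \<le> exp (2 * \<epsilon> * L)"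
      proof -
        have "16 / \<eta>\<^sup>2 = 2 * \<epsilon> * (8 / (\<epsilon> * \<eta>\<^sup>2))" using \<epsilon> by simp
        also have "\<dots> \<le> 2 * \<epsilon> * L" using L \<epsilon> by (intro mult_left_mono) auto
        also have "\<dots> \<le> exp (2 * \<epsilon> * L)" using exp_ge_add_one_self[of "2 * \<epsilon> * L"] by linarith
        finally show ?thesis .
      qed
      then have "exp (- 2 * \<epsilon> * L) \<le> \<eta>\<^sup>2 / 16"
        using \<eta> by (simp add: exp_minus field_simps)
      then have "real n * exp (- 2 * \<epsilon> * L) \<le> real n * (\<eta>\<^sup>2 / 16)"
        by (rule mult_left_mono) simp
      then have "real m * exp (- \<tau>\<^sup>2 / 2) \<le> real n * (\<eta>\<^sup>2 / 16)"
        by (rule order.trans[OF m\<tau>])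
      then have le: "2 * (real m * exp (- \<tau>\<^sup>2 / 2)) \<le> \<eta>\<^sup>2 * real n / 8"
        by (simp add: mult_ac)
      have "prob {\<omega>\<in>space M. \<eta>\<^sup>2 * real n < excess m n \<tau> (\<lambda>i j. A i j \<omega>) c} \<le>
          prob {\<omega>\<in>space M. \<eta>\<^sup>2 * real n \<le> excess m n \<tau> (\<lambda>i j. A i j \<omega>) c}"
        using meas by (intro finite_measure_mono) auto
      also have "\<dots> \<le> exp (- (\<eta>\<^sup>2 * real n) / 4 + 2 * (real m * exp (- \<tau>\<^sup>2 / 2)))"
        by (rule prob_excess[OF c \<tau>])
      also have "\<dots> \<le> exp (- (\<eta>\<^sup>2 * real n) / 8)"
        unfolding exp_le_cancel_iff using le by linarith
      also have "\<dots> = exp (- \<alpha> * real n)" by (simp add: \<alpha>_def \<eta>_def power_divide)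
      finally show ?thesis .
    qed
    ultimately show ?thesis using B(1) by blast
  next
    \<comment> \<open>Here the threshold is \<open>\<kappa> = 0\<close> and the bad event is empty:
      the matrix is controlled only through the excess.\<close>
    case False
    have "ereal (1 / ((1 + 2 * \<epsilon>) * sqrt (2 * L))) \<le> support_function n (polyhedron_of m n (\<lambda>i j. A i j \<omega>)) c"
      if "L2_set c {..<n} = 1" "excess m n \<tau> (\<lambda>i j. A i j \<omega>) c \<le> 0" for \<omega> c
      using that L by (intro support_function_ge[OF n \<epsilon>] disjI1) (auto simp: \<tau>_def)
    moreover have "prob {\<omega>\<in>space M. 0 < excess m n \<tau> (\<lambda>i j. A i j \<omega>) c} \<le> exp (- \<alpha> * real n)"
      if c: "L2_set c {..<n} = 1" for c
    proof -
      \<comment> \<open>The quadratic Taylor term suffices, as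
        \<open>(\<epsilon> * L)\<^sup>2\<close> is at least \<open>8 * L\<close>. Then
        \<open>n\<close> is below \<open>exp (\<epsilon> * L)\<close>, and half of the decay
        \<open>exp (- 2 * \<epsilon> * L)\<close> remains.\<close>
      have "4 * L \<le> exp (\<epsilon> * L)"
      proof -
        have "8 \<le> L * \<epsilon>\<^sup>2" using L(2) \<epsilon> by (simp add: divide_le_eq)
        then have "8 * L \<le> (\<epsilon> * L)\<^sup>2"
          using L(1) mult_right_mono[of 8 "L * \<epsilon>\<^sup>2" L] by (simp add: power2_eq_square mult_ac)
        moreover have "0 \<le> \<epsilon> * L" using L \<epsilon> by simp
        ultimately show ?thesis
          using exp_lower_Taylor_quadratic[of "\<epsilon> * L"] by linarith
      qed
      then have "real n \<le> exp (\<epsilon> * L)" using False by linarith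
      then have "real n * exp (- 2 * \<epsilon> * L) \<le> exp (\<epsilon> * L) * exp (- 2 * \<epsilon> * L)"
        by (rule mult_right_mono) simp
      also have "\<dots> = exp (- (\<epsilon> * L))" by (simp flip: exp_add)
      also have "\<dots> \<le> exp (- \<alpha> * real n)"
      proof -
        have "\<alpha> * real n \<le> \<epsilon> / 4 * (4 * L)"
          using False eps2 \<epsilon> by (intro mult_mono) (auto simp: \<alpha>_def)
        then show ?thesis by simp
      qed
      finally show ?thesis
        using prob_excess_pos[OF c \<tau>] m\<tau> by linarith
    qed
    ultimately show ?thesis by (intro bexI[of _ "{}"] exI[of _ 0]) auto
  qed
  then show "\<exists>B\<in>events. \<exists>\<kappa>. prob B \<le> 2 * exp (- (\<epsilon>\<^sup>2 / 80000) * real n) \<and>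
      (\<forall>\<omega>\<in>space M - B. \<forall>c. L2_set c {..<n} = 1 \<longrightarrow>
         excess m n ((1 + \<epsilon>) * sqrt (2 * ln (real m / real n))) (\<lambda>i j. A i j \<omega>) c \<le> \<kappa> \<longrightarrow>
         ereal (1 / ((1 + 2 * \<epsilon>) * sqrt (2 * ln (real m / real n)))) \<le>
           support_function n (polyhedron_of m n (\<lambda>i j. A i j \<omega>)) c) \<and>
      (\<forall>c. L2_set c {..<n} = 1 \<longrightarrow>
         prob {\<omega>\<in>space M. \<kappa> < excess m n ((1 + \<epsilon>) * sqrt (2 * ln (real m / real n))) (\<lambda>i j. A i j \<omega>) c}
           \<le> exp (- (\<epsilon>\<^sup>2 / 80000) * real n))"
    unfolding \<tau>_def \<alpha>_def L_def .
qed

lemma mean_width_ge_whp: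
  fixes \<epsilon> :: real
  assumes \<epsilon>: "0 < \<epsilon>" "\<epsilon> \<le> 1"
  obtains L\<^sub>0 :: real where "\<And>m n A. gaussian_matrix M m n A \<Longrightarrow> 1 \<le> n \<Longrightarrow> L\<^sub>0 \<le> ln (real m / real n) \<Longrightarrow>
    \<exists>B\<in>events. prob B \<le> (2 + 1 / \<epsilon>) * exp (- (\<epsilon>\<^sup>2 / 80000) * real n) \<and>
      (\<forall>\<omega>\<in>space M - B. ennreal (2 * (1 / ((1 + 2 * \<epsilon>) * sqrt (2 * ln (real m / real n)))) * (1 - \<epsilon>)) \<le>
         mean_width n (polyhedron_of m n (\<lambda>i j. A i j \<omega>)))"
proof -
  obtain L\<^sub>0 :: real where L\<^sub>0: "\<And>m n A. gaussian_matrix M m n A \<Longrightarrow> 1 \<le> n \<Longrightarrow> L\<^sub>0 \<le> ln (real m / real n) \<Longrightarrow>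
    \<exists>B\<in>events. \<exists>\<kappa>. prob B \<le> 2 * exp (- (\<epsilon>\<^sup>2 / 80000) * real n) \<and>
      (\<forall>\<omega>\<in>space M - B. \<forall>c. L2_set c {..<n} = 1 \<longrightarrow>
         excess m n ((1 + \<epsilon>) * sqrt (2 * ln (real m / real n))) (\<lambda>i j. A i j \<omega>) c \<le> \<kappa> \<longrightarrow>
         ereal (1 / ((1 + 2 * \<epsilon>) * sqrt (2 * ln (real m / real n)))) \<le>
           support_function n (polyhedron_of m n (\<lambda>i j. A i j \<omega>)) c) \<and>
      (\<forall>c. L2_set c {..<n} = 1 \<longrightarrow>
         prob {\<omega>\<in>space M. \<kappa> < excess m n ((1 + \<epsilon>) * sqrt (2 * ln (real m / real n))) (\<lambda>i j. A i j \<omega>) c}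
           \<le> exp (- (\<epsilon>\<^sup>2 / 80000) * real n))"
    by (rule support_function_ge_whp[OF \<epsilon>]) blast
  show ?thesis
  proof (rule that)
    fix m n :: nat and A :: "nat \<Rightarrow> nat \<Rightarrow> 'a \<Rightarrow> real"
    assume A: "gaussian_matrix M m n A" and n: "1 \<le> n" and L: "max 0 L\<^sub>0 \<le> ln (real m / real n)"
    interpret gaussian_matrix M m n A by fact
    define s where "s = sqrt (2 * ln (real m / real n))"
    have s: "0 \<le> s" using L by (simp add: s_def)
    define \<tau> where "\<tau> = (1 + \<epsilon>) * s"
    define \<beta> where "\<beta> = exp (- (\<epsilon>\<^sup>2 / 80000) * real n)"
    have "L\<^sub>0 \<le> ln (real m / real n)" using L by simp
    from L\<^sub>0[OF A n this] obtain B \<kappa> where B: "B \<in> events" "prob B \<le> 2 * \<beta>"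
      and supp: "\<And>\<omega> c. \<omega> \<in> space M - B \<Longrightarrow> L2_set c {..<n} = 1 \<Longrightarrow> excess m n \<tau> (\<lambda>i j. A i j \<omega>) c \<le> \<kappa> \<Longrightarrow>
        ereal (1 / ((1 + 2 * \<epsilon>) * s)) \<le> support_function n (polyhedron_of m n (\<lambda>i j. A i j \<omega>)) c"
      and exc: "\<And>c. L2_set c {..<n} = 1 \<Longrightarrow> prob {\<omega>\<in>space M. \<kappa> < excess m n \<tau> (\<lambda>i j. A i j \<omega>) c} \<le> \<beta>"
      unfolding \<tau>_def s_def \<beta>_def by blast
    interpret U: prob_space "uniform_sphere n" by (rule prob_space_uniform_sphere[OF n])
    have sets_U: "sets (uniform_sphere n) = sets (\<Pi>\<^sub>M i\<in>{..<n}. borel)"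
      by (simp add: uniform_sphere_def)
    have unit: "AE c in uniform_sphere n. L2_set c {..<n} = 1"
      using AE_uniform_sphere[OF n] by eventually_elim (simp add: unit_sphere_def)
    define D where "D \<omega> = {c\<in>space (uniform_sphere n). \<kappa> < excess m n \<tau> (\<lambda>i j. A i j \<omega>) c}" for \<omega>
    \<comment> \<open>The matrices for which directions of large excess fill a part
      \<open>\<epsilon>\<close> of the sphere; they account for the summand
      \<open>1 / \<epsilon>\<close> in the final constant.\<close>
    define E where "E = {\<omega>\<in>space M. \<epsilon> \<le> measure (uniform_sphere n) (D \<omega>)}"
    have "0 \<le> \<beta>" by (simp add: \<beta>_def)
    note E = prob_measure_excess[OF U.prob_space_axioms sets_U unit exc \<epsilon>(1) this,
        folded D_def, folded E_def]
    have D: "D \<omega> \<in> sets (uniform_sphere n)" for \<omega>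
    proof -
      have [measurable]: "(\<lambda>c. c j) \<in> borel_measurable (uniform_sphere n)" if "j < n" for j
        using that measurable_component_singleton[of j "{..<n}" "\<lambda>_. borel :: real measure"]
        by (simp cong: measurable_cong_sets add: sets_U)
      show ?thesis unfolding D_def excess_def by measurable
    qed
    have "prob (B \<union> E) \<le> prob B + prob E"
      using B E by (intro measure_Un_le) auto
    also have "\<dots> \<le> (2 + 1 / \<epsilon>) * \<beta>"
      using B E by (simp add: algebra_simps)
    finally have "prob (B \<union> E) \<le> (2 + 1 / \<epsilon>) * \<beta>" .
    moreover have "ennreal (2 * (1 / ((1 + 2 * \<epsilon>) * s)) * (1 - \<epsilon>)) \<le> mean_width n (polyhedron_of m n (\<lambda>i j. A i j \<omega>))"
      if \<omega>: "\<omega> \<in> space M - (B \<union> E)" for \<omega>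
    proof (rule mean_width_ge[OF n])
      show "space (uniform_sphere n) - D \<omega> \<in> sets (uniform_sphere n)"
        using D by auto
      show "1 - \<epsilon> \<le> U.prob (space (uniform_sphere n) - D \<omega>)"
        using \<omega> by (subst U.prob_compl[OF D]) (auto simp: E_def)
      fix c assume "c \<in> space (uniform_sphere n) - D \<omega>" "L2_set c {..<n} = 1"
      then show "ereal (1 / ((1 + 2 * \<epsilon>) * s)) \<le> support_function n (polyhedron_of m n (\<lambda>i j. A i j \<omega>)) c"
        using \<omega> by (intro supp) (auto simp: D_def)
    qed (use s \<epsilon> in auto)
    ultimately show "\<exists>B\<in>events. prob B \<le> (2 + 1 / \<epsilon>) * exp (- (\<epsilon>\<^sup>2 / 80000) * real n) \<and>
      (\<forall>\<omega>\<in>space M - B. ennreal (2 * (1 / ((1 + 2 * \<epsilon>) * sqrt (2 * ln (real m / real n)))) * (1 - \<epsilon>)) \<le>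
         mean_width n (polyhedron_of m n (\<lambda>i j. A i j \<omega>)))"
      using B E unfolding s_def \<beta>_def by blast
  qed
qed

end

theorem corollary1p5:
  fixes M :: "'a measure"
    and m :: "nat \<Rightarrow> nat"
    and A :: "nat \<Rightarrow> nat \<Rightarrow> nat \<Rightarrow> 'a \<Rightarrow> real"
  assumes "prob_space M"
    and "\<And>n. n \<ge> 1 \<Longrightarrow> m n > 0"
    and "filterlim (\<lambda>n. real (m n) / real n) at_top sequentially"
    and "\<And>n i j. n \<ge> 1 \<Longrightarrow> i < m n \<Longrightarrow> j < n \<Longrightarrow>
           distributed M lborel (A n i j) std_normal_density"
    and "\<And>n. n \<ge> 1 \<Longrightarrow>
           prob_space.indep_vars M (\<lambda>_. borel) (\<lambda>(i, j). A n i j) ({..<m n} \<times> {..<n})"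
  shows "AE \<omega> in M.
           (\<lambda>n. ennreal (sqrt (2 * ln (real (m n) / real n))) *
                 mean_width n (polyhedron_of (m n) n (\<lambda>i j. A n i j \<omega>)))
           \<longlonglongrightarrow> 2"
proof -
  interpret prob_space M by fact
  have gauss: "gaussian_matrix M (m n) n (A n)" if "n \<ge> 1" for n
    using assms(4,5)[OF that] by unfold_locales auto
  define L where "L n = ln (real (m n) / real n)" for n
  define s where "s n = sqrt (2 * L n)" for n
  define W where "W n \<omega> = mean_width n (polyhedron_of (m n) n (\<lambda>i j. A n i j \<omega>))" for n \<omega>
  have L_top: "filterlim L at_top sequentially"
    unfolding L_def by (rule filterlim_compose[OF ln_at_top assms(3)])
  \<comment> \<open>A sequence of tolerances tending to 0, so that the almost sure events for all of
    them can be intersected countably.\<close>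
  define \<delta> where "\<delta> q = 1 / (real q + 2)" for q :: nat
  have \<delta>: "0 < \<delta> q" "\<delta> q \<le> 1" for q by (auto simp: \<delta>_def)
  have "AE \<omega> in M. \<forall>\<^sub>F n in sequentially. ennreal (s n) * W n \<omega> \<le> ennreal (2 * (1 + \<delta> q))" for q
  proof (rule AE_eventually_of_exponential_bound)
    obtain L\<^sub>0 :: real where L\<^sub>0: "\<And>m n A. gaussian_matrix M m n A \<Longrightarrow> 1 \<le> n \<Longrightarrow> L\<^sub>0 \<le> ln (real m / real n) \<Longrightarrow>
      \<exists>B\<in>events. prob B \<le> exp (- real n) \<and>
        (\<forall>\<omega>\<in>space M - B. \<forall>x\<in>polyhedron_of m n (\<lambda>i j. A i j \<omega>).
           L2_set x {..<n} \<le> (1 + \<delta> q) / sqrt (2 * ln (real m / real n)))"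
      by (rule polyhedron_subset_ball_whp[OF \<delta>]) blast
    have "\<forall>\<^sub>F n in sequentially. max 1 L\<^sub>0 \<le> L n"
      using L_top unfolding filterlim_at_top by blast
    then show "\<forall>\<^sub>F n in sequentially. \<exists>B\<in>events. prob B \<le> 1 * exp (- 1 * real n) \<and>
        (\<forall>\<omega>\<in>space M - B. ennreal (s n) * W n \<omega> \<le> ennreal (2 * (1 + \<delta> q)))"
      using eventually_ge_at_top[of 1]
    proof eventually_elim
      case (elim n)
      then have s: "0 < s n" and "L\<^sub>0 \<le> ln (real (m n) / real n)" by (auto simp: s_def L_def)
      from L\<^sub>0[OF gauss[OF elim(2)] elim(2) this(2)] obtain B where B: "B \<in> events" "prob B \<le> exp (- real n)"
        and ball: "\<And>\<omega> x. \<omega> \<in> space M - B \<Longrightarrow> x \<in> polyhedron_of (m n) n (\<lambda>i j. A n i j \<omega>) \<Longrightarrow>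
            L2_set x {..<n} \<le> (1 + \<delta> q) / s n"
        unfolding s_def L_def by blast
      have "ennreal (s n) * W n \<omega> \<le> ennreal (2 * (1 + \<delta> q))" if "\<omega> \<in> space M - B" for \<omega>
      proof -
        have "ennreal (s n) * W n \<omega> \<le> ennreal (s n) * ennreal (2 * ((1 + \<delta> q) / s n))"
          unfolding W_def using s \<delta>(1)[of q] by (intro mult_left_mono mean_width_le elim ball[OF that]) auto
        also have "\<dots> = ennreal (2 * (1 + \<delta> q))"
          using s \<delta>(1)[of q] by (simp flip: ennreal_mult)
        finally show ?thesis .
      qed
      with B show ?case by auto
    qed
  qed simp
  then have upper: "AE \<omega> in M. \<forall>q. \<forall>\<^sub>F n in sequentially. ennreal (s n) * W n \<omega> \<le> ennreal (2 * (1 + \<delta> q))"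
    by (simp add: AE_all_countable)
  have "AE \<omega> in M. \<forall>\<^sub>F n in sequentially. ennreal (2 * (1 - \<delta> q) / (1 + 2 * \<delta> q)) \<le> ennreal (s n) * W n \<omega>" for q
  proof (rule AE_eventually_of_exponential_bound)
    obtain L\<^sub>0 :: real where L\<^sub>0: "\<And>m n A. gaussian_matrix M m n A \<Longrightarrow> 1 \<le> n \<Longrightarrow> L\<^sub>0 \<le> ln (real m / real n) \<Longrightarrow>
      \<exists>B\<in>events. prob B \<le> (2 + 1 / \<delta> q) * exp (- ((\<delta> q)\<^sup>2 / 80000) * real n) \<and>
        (\<forall>\<omega>\<in>space M - B. ennreal (2 * (1 / ((1 + 2 * \<delta> q) * sqrt (2 * ln (real m / real n)))) * (1 - \<delta> q)) \<le>
           mean_width n (polyhedron_of m n (\<lambda>i j. A i j \<omega>)))"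
      by (rule mean_width_ge_whp[OF \<delta>]) blast
    have "\<forall>\<^sub>F n in sequentially. max 1 L\<^sub>0 \<le> L n"
      using L_top unfolding filterlim_at_top by blast
    then show "\<forall>\<^sub>F n in sequentially. \<exists>B\<in>events. prob B \<le> (2 + 1 / \<delta> q) * exp (- ((\<delta> q)\<^sup>2 / 80000) * real n) \<and>
        (\<forall>\<omega>\<in>space M - B. ennreal (2 * (1 - \<delta> q) / (1 + 2 * \<delta> q)) \<le> ennreal (s n) * W n \<omega>)"
      using eventually_ge_at_top[of 1]
    proof eventually_elim
      case (elim n)
      then have s: "0 < s n" and "L\<^sub>0 \<le> ln (real (m n) / real n)" by (auto simp: s_def L_def)
      from L\<^sub>0[OF gauss[OF elim(2)] elim(2) this(2)] obtain B where B: "B \<in> events"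
          "prob B \<le> (2 + 1 / \<delta> q) * exp (- ((\<delta> q)\<^sup>2 / 80000) * real n)"
        and width: "\<And>\<omega>. \<omega> \<in> space M - B \<Longrightarrow> ennreal (2 * (1 / ((1 + 2 * \<delta> q) * s n)) * (1 - \<delta> q)) \<le> W n \<omega>"
        unfolding s_def L_def W_def by blast
      have "ennreal (2 * (1 - \<delta> q) / (1 + 2 * \<delta> q)) \<le> ennreal (s n) * W n \<omega>" if "\<omega> \<in> space M - B" for \<omega>
      proof -
        \<comment> \<open>The scaling \<open>s n\<close> cancels exactly, leaving a lower bound that
          depends on the tolerance only and tends to 2 with it.\<close>
        have "2 * (1 - \<delta> q) / (1 + 2 * \<delta> q) = s n * (2 * (1 / ((1 + 2 * \<delta> q) * s n)) * (1 - \<delta> q))"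
          using s by simp
        then have "ennreal (2 * (1 - \<delta> q) / (1 + 2 * \<delta> q)) =
            ennreal (s n) * ennreal (2 * (1 / ((1 + 2 * \<delta> q) * s n)) * (1 - \<delta> q))"
          using s by (simp only: ennreal_mult' less_imp_le)
        also have "\<dots> \<le> ennreal (s n) * W n \<omega>"
          by (intro mult_left_mono width that) simp
        finally show ?thesis .
      qed
      with B show ?case by blast
    qed
  qed (use \<delta>(1)[of q] in simp)
  then have lower: "AE \<omega> in M. \<forall>q. \<forall>\<^sub>F n in sequentially.
      ennreal (2 * (1 - \<delta> q) / (1 + 2 * \<delta> q)) \<le> ennreal (s n) * W n \<omega>"
    by (simp add: AE_all_countable)
  have "\<delta> \<longlonglongrightarrow> 0"
    unfolding \<delta>_def by real_asymp
  then have "(\<lambda>q. ennreal (2 * (1 + \<delta> q))) \<longlonglongrightarrow> ennreal (2 * (1 + 0))"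
    and "(\<lambda>q. ennreal (2 * (1 - \<delta> q) / (1 + 2 * \<delta> q))) \<longlonglongrightarrow> ennreal (2 * (1 - 0) / (1 + 2 * 0))"
    by (intro tendsto_intros tendsto_ennrealI; simp)+
  then have lim: "(\<lambda>q. ennreal (2 * (1 + \<delta> q))) \<longlonglongrightarrow> 2"
    "(\<lambda>q. ennreal (2 * (1 - \<delta> q) / (1 + 2 * \<delta> q))) \<longlonglongrightarrow> 2"
    by simp_all
  from upper lower show ?thesis
  proof eventually_elim
    case (elim \<omega>)
    have "(\<lambda>n. ennreal (s n) * W n \<omega>) \<longlonglongrightarrow> 2"
    proof (rule order_tendstoI)
      fix a :: ennreal assume "a < 2"
      then obtain q where "a < ennreal (2 * (1 - \<delta> q) / (1 + 2 * \<delta> q))"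
        using order_tendstoD(1)[OF lim(2)] by (auto simp: eventually_sequentially)
      then show "\<forall>\<^sub>F n in sequentially. a < ennreal (s n) * W n \<omega>"
        using elim(2)[rule_format, of q] by (auto elim!: eventually_mono intro: less_le_trans)
    next
      fix a :: ennreal assume "2 < a"
      then obtain q where "ennreal (2 * (1 + \<delta> q)) < a"
        using order_tendstoD(2)[OF lim(1)] by (auto simp: eventually_sequentially)
      then show "\<forall>\<^sub>F n in sequentially. ennreal (s n) * W n \<omega> < a"
        using elim(1)[rule_format, of q] by (auto elim!: eventually_mono intro: le_less_trans)
    qed
    then show ?case by (simp add: s_def L_def W_def)
  qed
qed

end
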